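(* Let $(\theta,\varphi)$ be a Markov random dynamical system (RDS) over a probability space $(\Omega,\mathcal F,\mathbb P)$ on a countable state space $\mathbb X$, representing a discrete-time Markov chain which is irreducible and positive recurrent, with unique stationary distribution $\pi$. (a) There is an $\mathcal F_{-\infty}^0$-measurable invariant compact random set $A$ which is a pullback attractor for finite deterministic sets and a forward attractor for compact random sets. (b) $A$ is the unique attractor in the following sense: up to $\mathbb P$-null sets, $A$ is the only invariant compact random set satisfying some notion of attraction among those listed in the context (pullback, forward or weak attractor, for compact random sets, for finite deterministic sets, or for points). That is, if $A'$ is an invariant compact random set satisfying at least one of these notions, then $A'(\omega)=A(\omega)$ for $\mathbb P$-a.e. $\omega\in\Omega$. (c) There is a constant $\kappa\in\mathbb N_{>0}$ such that $|A(\omega)|=\kappa$ for $\mathbb P$-a.e. $\omega\in\Omega$. (d) For every $x\in\mathbb X$, the probability that $x$ lies in the attractor is $$\mathbb P(x\in A(\omega))=\kappa\,\pi(x).$$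
   Context: $\mathbb N$ includes $0$. $\mathbb X$ is countable with the discrete topology and the power set $\sigma$-algebra $\mathcal P(\mathbb X)$; compact means finite. RDS: An RDS $(\theta,\varphi)$ on $\mathbb X$ consists of a probability space $(\Omega,\mathcal F,\mathbb P)$; a group $(\theta_n)_{n\in\mathbb Z}$ of bimeasurable measure-preserving maps $\theta_n:\Omega\to\Omega$ with $\theta_0=\mathrm{id}$, $\theta_{n+m}=\theta_n\circ\theta_m$, where $\theta:=\theta_1$ is assumed ergodic with respect to $\mathbb P$; and an $(\mathcal F\otimes\mathcal P(\mathbb N)\otimes\mathcal P(\mathbb X))$-measurable map $\varphi:\Omega\times\mathbb N\times\mathbb X\to\mathbb X$, $(\omega,n,x)\mapsto\varphi^n_\omega(x)$, with $\varphi^0_\omega(x)=x$ and $\varphi^{n+m}_\omega(x)=\varphi^n_{\theta_m\omega}(\varphi^m_\omega(x))$ for all $\omega\in\Omega$, $m,n\in\mathbb N$, $x\in\mathbb X$. Write $\varphi_\omega:=\varphi^1_\omega$; for $K\subset\mathbb X$, $\varphi^n_\omega(K)=\{\varphi^n_\omega(x):x\in K\}$. Markov RDS: for $s<t$ in $\mathbb Z$, $\mathcal F_s^t\subset\mathcal F$ is the $\sigma$-algebra generated by the $\mathbb P$-null sets of $\mathcal F$ and the random variables $\omega\mapsto\varphi^n_{\theta_m\omega}(x)$ for $x\in\mathbb X$ and integers $m,n$ with $s\le m\le m+n\le t$. $\mathcal F_{-\infty}^t:=\sigma(\mathcal F_s^t: s<t)$, $\mathcal F_s^\infty:=\sigma(\mathcal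 F_s^t: t>s)$. The RDS is Markov if $\mathcal F_{-\infty}^0$ and $\mathcal F_0^\infty$ are independent. Then $X_n(\omega)=\varphi^n_\omega(x)$ is a time-homogeneous Markov chain with transition probabilities $P(x,y)=\mathbb P(\varphi_\omega(x)=y)$; the RDS is said to represent this (associated) Markov chain. No aperiodicity is assumed. Compact random set: a map $B:\Omega\to\mathcal P(\mathbb X)$ such that $\omega\mapsto\mathbf 1_{B(\omega)}(x)$ is measurable for each $x\in\mathbb X$ and $B(\omega)$ is finite for $\mathbb P$-a.e. $\omega$. It is invariant if also $\varphi_\omega(B(\omega))=B(\theta\omega)$ for $\mathbb P$-a.e. $\omega$. It is $\mathcal F_{-\infty}^0$-measurable if $\omega\mapsto\mathbf 1_{B(\omega)}(x)$ is $\mathcal F_{-\infty}^0$-measurable for each $x$. Notions of attraction: an invariant compact random set $A$ is called - a pullback attractor for compact random sets if for each compact random set $B$: $\mathbb P(\exists N\in\mathbb N\ \forall n\ge N:\ \varphi^n_{\theta_{-n}\omega}(B(\theta_{-n}\omega))\subset A(\omega))=1$; - a forward attractor for compact random sets if for each compact random set $B$: $\mathbb P(\exists N\in\mathbb N\ \forall n\ge N:\ \varphi^n_\omega(B(\omega))\subset A(\theta_n\omega))=1$; - a weak attractor for compact random sets if for each compact random set $B$: $\lim_{n\to\infty}\mathbb P(\varphi^n_{\theta_{-n}\omega}(B(\theta_{-n}\omega))\subset A(\omega))=1$ and $\lim_{n\to\infty}\mathbb P(\varphi^n_\omega(B(\omega))\subset A(\theta_n\omega))=1$ (the two conditions are equivalent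 since $\theta$ preserves $\mathbb P$); - a pullback/forward/weak attractor for finite deterministic sets if the respective condition holds for all finite deterministic sets $B\subset\mathbb X$; - a pullback/forward/weak point attractor if the respective condition holds for all singletons $B=\{x\}$, $x\in\mathbb X$. *)

theory Defs
  imports "HOL-Probability.Probability"
begin

(* phi n omega x stands for phi^n_omega(x). The state space is the whole type 'x of class
   countable (finite or countably infinite), always with the discrete sigma-algebra.
   Each theta n has the measurable inverse theta (-n) by the group law, so bimeasurability need
   not be assumed separately. *)
locale rds = prob_space M
  for M :: "'w measure"
  and \<theta> :: "int \<Rightarrow> 'w \<Rightarrow> 'w"
  and \<phi> :: "nat \<Rightarrow> 'w \<Rightarrow> 'x :: countable \<Rightarrow> 'x" +
  assumes theta_measurable: "\<theta> n \<in> M \<rightarrow>\<^sub>M M"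
    and theta_measure_preserving: "distr M M (\<theta> n) = M"
    and theta_zero: "\<omega> \<in> space M \<Longrightarrow> \<theta> 0 \<omega> = \<omega>"
    and theta_add: "\<omega> \<in> space M \<Longrightarrow> \<theta> (n + m) \<omega> = \<theta> n (\<theta> m \<omega>)"
    and theta_ergodic:
      "E \<in> sets M \<Longrightarrow> \<theta> 1 -` E \<inter> space M = E \<Longrightarrow> prob E = 0 \<or> prob E = 1"
    and phi_measurable:
      "(\<lambda>(\<omega>, k, x). \<phi> k \<omega> x)
        \<in> M \<Otimes>\<^sub>M (count_space UNIV \<Otimes>\<^sub>M count_space UNIV) \<rightarrow>\<^sub>M count_space UNIV"
    and phi_zero: "\<omega> \<in> space M \<Longrightarrow> \<phi> 0 \<omega> x = x"
    and phi_cocycle: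
      "\<omega> \<in> space M \<Longrightarrow> \<phi> (k + l) \<omega> x = \<phi> k (\<theta> (int l) \<omega>) (\<phi> l \<omega> x)"
begin

(* F_s^t. The sigma-algebras are encoded as measures; only their space and sets matter. *)
definition window_algebra :: "int \<Rightarrow> int \<Rightarrow> 'w measure" where
  "window_algebra s t = sigma (space M)
     (null_sets M \<union>
      {(\<lambda>\<omega>. \<phi> n (\<theta> m \<omega>) x) -` S \<inter> space M | x m n S. s \<le> m \<and> m + int n \<le> t})"

definition past_algebra :: "int \<Rightarrow> 'w measure" where
  "past_algebra t = sigma (space M) (\<Union>s\<in>{..<t}. sets (window_algebra s t))"

definition future_algebra :: "int \<Rightarrow> 'w measure" where
  "future_algebra s = sigma (space M) (\<Union>t\<in>{s<..}. sets (window_algebra s t))"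

(* Notions for the associated Markov chain. The chain started in x is X_n = phi^n_omega(x), so
   the n-step transition probability P^n(x,y) is the probability that X_n = y. *)

definition transition_prob :: "'x \<Rightarrow> 'x \<Rightarrow> real" where
  "transition_prob x y = \<P>(\<omega> in M. \<phi> 1 \<omega> x = y)"

definition irreducible_chain :: bool where
  "irreducible_chain \<longleftrightarrow> (\<forall>x y. \<exists>n. \<P>(\<omega> in M. \<phi> n \<omega> x = y) > 0)"

(* First return time of the chain started in x; it is top if there is no return. *)
definition return_time :: "'x \<Rightarrow> 'w \<Rightarrow> ennreal" where
  "return_time x \<omega> = (INF n\<in>{n. 1 \<le> n \<and> \<phi> n \<omega> x = x}. of_nat n)"

(* A finite mean return time forces the return time to be almost surely finite. *)
definition positive_recurrent_chain :: bool where
  "positive_recurrent_chain \<longleftrightarrow> (\<forall>x. (\<integral>\<^sup>+ \<omega>. return_time x \<omega> \<partial>M) < \<infinity>)"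

definition stationary_distribution :: "'x pmf \<Rightarrow> bool" where
  "stationary_distribution \<pi> \<longleftrightarrow>
     (\<forall>y. ((\<lambda>x. pmf \<pi> x * transition_prob x y) has_sum pmf \<pi> y) UNIV)"

definition set_measurable_wrt :: "'w measure \<Rightarrow> ('w \<Rightarrow> 'x set) \<Rightarrow> bool" where
  "set_measurable_wrt F B \<longleftrightarrow>
     (\<forall>x. (\<lambda>\<omega>. indicator (B \<omega>) x :: real) \<in> borel_measurable F)"

definition compact_random_set :: "('w \<Rightarrow> 'x set) \<Rightarrow> bool" where
  "compact_random_set B \<longleftrightarrow> set_measurable_wrt M B \<and> (AE \<omega> in M. finite (B \<omega>))"

definition invariant_compact_random_set :: "('w \<Rightarrow> 'x set) \<Rightarrow> bool" where
  "invariant_compact_random_set B \<longleftrightarrow>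
     compact_random_set B \<and> (AE \<omega> in M. \<phi> 1 \<omega> ` B \<omega> = B (\<theta> 1 \<omega>))"

(* The families of sets to be attracted; deterministic sets are constant random sets. *)

definition compact_random_sets :: "('w \<Rightarrow> 'x set) set" where
  "compact_random_sets = {B. compact_random_set B}"

definition finite_deterministic_sets :: "('w \<Rightarrow> 'x set) set" where
  "finite_deterministic_sets = {\<lambda>_. K | K. finite K}"

definition deterministic_points :: "('w \<Rightarrow> 'x set) set" where
  "deterministic_points = {\<lambda>_. {x} | x. True}"

definition pullback_attractor :: "('w \<Rightarrow> 'x set) set \<Rightarrow> ('w \<Rightarrow> 'x set) \<Rightarrow> bool" where
  "pullback_attractor \<B> A \<longleftrightarrow> invariant_compact_random_set A \<and>
     (\<forall>B\<in>\<B>. \<P>(\<omega> in M. \<exists>N. \<forall>n\<ge>N.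
        \<phi> n (\<theta> (- int n) \<omega>) ` B (\<theta> (- int n) \<omega>) \<subseteq> A \<omega>) = 1)"

definition forward_attractor :: "('w \<Rightarrow> 'x set) set \<Rightarrow> ('w \<Rightarrow> 'x set) \<Rightarrow> bool" where
  "forward_attractor \<B> A \<longleftrightarrow> invariant_compact_random_set A \<and>
     (\<forall>B\<in>\<B>. \<P>(\<omega> in M. \<exists>N. \<forall>n\<ge>N. \<phi> n \<omega> ` B \<omega> \<subseteq> A (\<theta> (int n) \<omega>)) = 1)"

definition weak_attractor :: "('w \<Rightarrow> 'x set) set \<Rightarrow> ('w \<Rightarrow> 'x set) \<Rightarrow> bool" where
  "weak_attractor \<B> A \<longleftrightarrow> invariant_compact_random_set A \<and>
     (\<forall>B\<in>\<B>.
        (\<lambda>n. \<P>(\<omega> in M. \<phi> n (\<theta> (- int n) \<omega>) ` B (\<theta> (- int n) \<omega>) \<subseteq> A \<omega>))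
          \<longlonglongrightarrow> 1 \<and>
        (\<lambda>n. \<P>(\<omega> in M. \<phi> n \<omega> ` B \<omega> \<subseteq> A (\<theta> (int n) \<omega>))) \<longlonglongrightarrow> 1)"

definition some_attractor :: "('w \<Rightarrow> 'x set) \<Rightarrow> bool" where
  "some_attractor A \<longleftrightarrow>
     (\<exists>\<B>\<in>{compact_random_sets, finite_deterministic_sets, deterministic_points}.
        pullback_attractor \<B> A \<or> forward_attractor \<B> A \<or> weak_attractor \<B> A)"

end

locale markov_rds = rds M \<theta> \<phi>
  for M :: "'w measure"
  and \<theta> :: "int \<Rightarrow> 'w \<Rightarrow> 'w"
  and \<phi> :: "nat \<Rightarrow> 'w \<Rightarrow> 'x :: countable \<Rightarrow> 'x" +
  assumes markov: "indep_set (sets (past_algebra 0)) (sets (future_algebra 0))"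

end

theory Submission
  imports Defs
begin

text \<open>Transport the stationary distribution \<open>\<pi>\<close> from time \<open>- n\<close> to time \<open>0\<close>. By the Markov property the
  mass which this puts on a state is a bounded martingale in \<open>n\<close>, so it converges almost surely, and the
  limits form a random probability \<open>\<mu>\<close> which the cocycle carries along. The largest atom of \<open>\<mu>\<close> does not
  decrease along orbits, hence is almost surely constant, and the set \<open>A\<close> of its maximal atoms has a
  constant number \<open>\<kappa>\<close> of elements and is invariant. Since \<open>A\<close> depends only on the past,
  \<open>P(x \<in> A) / \<kappa>\<close> is stationary, so it equals \<open>\<pi>(x)\<close>; therefore the uniform distribution on \<open>A\<close> is the
  limit of the same martingale and coincides with \<open>\<mu>\<close>. Thus all of \<open>\<pi>\<close> is eventually transported into
  \<open>A\<close>, and as every state has positive mass this is pullback attraction. Forward attraction follows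
  because entering \<open>A\<close> is irreversible. An invariant set \<open>A'\<close> attracting points in probability must carry
  \<open>\<mu>\<close>, so it contains \<open>A\<close>; conversely it is attracted by \<open>A\<close> and, by stationarity, contained in it.\<close>

section \<open>Almost sure convergence of bounded martingales\<close>

text \<open>The chain may be periodic, so the laws of \<phi> n \<omega> x need not converge.
  Starting from \<pi> removes this obstacle: by stationarity one further step into the past does not
  change the mean of the mass on a state, and averaging over that step is exactly the martingale
  identity. The second obstacle is that a limit taken inside an infinite sum over states gives only
  Fatou inequalities: mass might escape, and the limit mass is carried along only as a lower bound.
  Each one-sided statement becomes an equality because some finite quantity is conserved: the total
  expected mass, the total mass of a stationary density, the size of the set of maximal atoms, or a
  mean that the shift preserves. The two halves of (a) differ for a reason. In forward time \<omega>
  fixes one finite set \<open>B \<omega>\<close>, and finitely many entrance times have a maximum.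
  In pullback time the set \<open>B (\<theta> (- int n) \<omega>)\<close> changes with
  \<open>n\<close>, and attraction of each fixed state gives no uniform control over it.\<close>

lemma (in prob_space) bounded_martingale_AE_convergent:
  fixes X :: "nat \<Rightarrow> 'a \<Rightarrow> real" and F :: "nat \<Rightarrow> 'a measure"
  assumes sub: "\<And>n. subalgebra M (F n)"
    and mono: "\<And>n. sets (F n) \<subseteq> sets (F (Suc n))"
    and X: "\<And>n. X n \<in> borel_measurable (F n)"
    and bound: "\<And>n \<omega>. \<omega> \<in> space M \<Longrightarrow> \<bar>X n \<omega>\<bar> \<le> B"
    and martingale: "\<And>n G. G \<in> sets (F n) \<Longrightarrow>
      (\<integral>\<omega>. indicator G \<omega> * X (Suc n) \<omega> \<partial>M) = (\<integral>\<omega>. indicator G \<omega> * X n \<omega> \<partial>M)"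
  shows "AE \<omega> in M. convergent (\<lambda>n. X n \<omega>)"
proof -
  have XM[measurable]: "X n \<in> borel_measurable M" for n
    using measurable_from_subalg[OF sub X] .
  have mono': "sets (F n) \<subseteq> sets (F m)" if "n \<le> m" for n m
    using that mono by (rule lift_Suc_mono_le[of "\<lambda>n. sets (F n)", rotated])
  have setsM: "G \<in> sets M" if "G \<in> sets (F n)" for G n
    using sub[of n] that by (auto simp: subalgebra_def)
  have spF: "space (F n) = space M" for n
    using sub[of n] by (auto simp: subalgebra_def)
  have int: "integrable M f"
    if "f \<in> borel_measurable M" "\<And>\<omega>. \<omega> \<in> space M \<Longrightarrow> \<bar>f \<omega>\<bar> \<le> C" for f :: "'a \<Rightarrow> real" and C
    using that by (intro integrable_const_bound[where B=C]) auto
  have B0: "0 \<le> B" using not_empty bound by force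
  have XF: "X n \<in> borel_measurable (F m)" if "n \<le> m" for n m
    using measurable_mono[of borel borel "F n" "F m"] mono'[OF that] X[of n] spF by auto
  have mart: "(\<integral>\<omega>. indicator G \<omega> * X m \<omega> \<partial>M) = (\<integral>\<omega>. indicator G \<omega> * X n \<omega> \<partial>M)"
    if "G \<in> sets (F n)" "n \<le> m" for G n m
    using \<open>n \<le> m\<close>
  proof (induction rule: dec_induct)
    case (step l)
    then show ?case using martingale[of G l] mono'[of n l] that(1) by auto
  qed simp
  have d: "\<bar>X i \<omega> - X j \<omega>\<bar> \<le> 2 * B" if "\<omega> \<in> space M" for i j \<omega>
    using bound[OF that, of i] bound[OF that, of j] by linarith
  have d2: "(X i \<omega> - X j \<omega>)\<^sup>2 \<le> (2 * B)\<^sup>2" if "\<omega> \<in> space M" for i j \<omega>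
    using power_mono[OF d[OF that, of i j], of 2] by simp
  have i: "integrable M (\<lambda>\<omega>. indicator H \<omega> * (X i \<omega> - X j \<omega>)\<^sup>2)" if [measurable]: "H \<in> sets M" for H i j
    by (rule int[of _ "(2 * B)\<^sup>2"]) (use d2 in \<open>auto simp: indicator_def\<close>)
  \<comment> \<open>Chebyshev's bound for the event \<open>G\<close>, with the second moment taken
    over the possibly larger event \<open>H\<close>.\<close>
  have chebyshev: "e\<^sup>2 * measure M G \<le> (\<integral>\<omega>. indicator H \<omega> * (X i \<omega> - X k \<omega>)\<^sup>2 \<partial>M)"
    if [measurable]: "G \<in> sets M" "H \<in> sets M" and G: "G \<subseteq> H" "\<And>\<omega>. \<omega> \<in> G \<Longrightarrow> e < \<bar>X i \<omega> - X k \<omega>\<bar>" and "0 < e"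
    for e G H i k
  proof -
    have "e\<^sup>2 * measure M G = (\<integral>\<omega>. e\<^sup>2 * indicator G \<omega> \<partial>M)"
      using sets.sets_into_space[of G M] by (simp add: Int_absorb2)
    also have "\<dots> \<le> (\<integral>\<omega>. indicator H \<omega> * (X i \<omega> - X k \<omega>)\<^sup>2 \<partial>M)"
    proof (rule integral_mono)
      fix \<omega> assume "\<omega> \<in> space M"
      have "e\<^sup>2 \<le> (X i \<omega> - X k \<omega>)\<^sup>2" if "\<omega> \<in> G"
        using G(2)[OF that] \<open>0 < e\<close> by (intro abs_le_square_iff[THEN iffD1]) auto
      then show "e\<^sup>2 * indicator G \<omega> \<le> indicator H \<omega> * (X i \<omega> - X k \<omega>)\<^sup>2"
        using G(1) by (auto simp: indicator_def)
    next
      show "integrable M (\<lambda>\<omega>. e\<^sup>2 * indicator G \<omega> :: real)"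
        by (rule int[of _ "e\<^sup>2"]) (auto simp: indicator_def)
    qed (auto intro!: i)
    finally show ?thesis .
  qed
  \<comment> \<open>The hypothesis tests increments against indicators only. Identifying
    \<open>X n\<close> with the conditional expectation of \<open>X m\<close> extends this to every
    bounded \<open>F n\<close>-measurable factor.\<close>
  have orth: "(\<integral>\<omega>. Z \<omega> * (X m \<omega> - X n \<omega>) \<partial>M) = 0"
    if Z: "Z \<in> borel_measurable (F n)" and Zb: "\<And>\<omega>. \<omega> \<in> space M \<Longrightarrow> \<bar>Z \<omega>\<bar> \<le> C" and nm: "n \<le> m"
    for Z C n m
  proof -
    interpret finite_measure_subalgebra M "F n" by unfold_locales (rule sub)
    have [measurable]: "Z \<in> borel_measurable M" using measurable_from_subalg[OF sub Z] .
    have C: "0 \<le> C" using not_empty Zb by force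
    have i: "integrable M (\<lambda>\<omega>. Z \<omega> * X j \<omega>)" for j
      by (rule int[of _ "C * B"]) (auto simp: abs_mult intro!: mult_mono Zb bound C)
    have iX: "integrable M (X j)" for j by (rule int[of _ B]) (auto simp: bound)
    have "AE \<omega> in M. real_cond_exp M (F n) (X m) \<omega> = X n \<omega>"
      by (rule real_cond_exp_charact) (simp_all add: set_lebesgue_integral_def mart[OF _ nm] iX X)
    then have "AE \<omega> in M. Z \<omega> * real_cond_exp M (F n) (X m) \<omega> = Z \<omega> * X n \<omega>" by auto
    then have "(\<integral>\<omega>. Z \<omega> * X n \<omega> \<partial>M) = (\<integral>\<omega>. Z \<omega> * real_cond_exp M (F n) (X m) \<omega> \<partial>M)"
      by (intro integral_cong_AE) auto
    also have "\<dots> = (\<integral>\<omega>. Z \<omega> * X m \<omega> \<partial>M)"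
      by (rule real_cond_exp_intg(2)) (auto simp: i Z)
    finally show ?thesis by (simp add: right_diff_distrib i)
  qed
  \<comment> \<open>Pythagoras on an event of \<open>F n\<close>: the cross term vanishes by
    \<open>orth\<close>. The condition \<open>k \<le> n\<close> makes the earlier increment
    \<open>F n\<close>-measurable.\<close>
  have sq: "(\<integral>\<omega>. indicator H \<omega> * (X m \<omega> - X k \<omega>)\<^sup>2 \<partial>M)
      = (\<integral>\<omega>. indicator H \<omega> * (X m \<omega> - X n \<omega>)\<^sup>2 \<partial>M) + (\<integral>\<omega>. indicator H \<omega> * (X n \<omega> - X k \<omega>)\<^sup>2 \<partial>M)"
    if H: "H \<in> sets (F n)" and kn: "k \<le> n" and nm: "n \<le> m" for H m n k
  proof -
    have [measurable]: "H \<in> sets M" using setsM[OF H] .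
    have Z: "(\<lambda>\<omega>. 2 * indicator H \<omega> * (X n \<omega> - X k \<omega>)) \<in> borel_measurable (F n)"
      using X[of n] XF[OF kn] H by auto
    have Zb: "\<bar>2 * indicator H \<omega> * (X n \<omega> - X k \<omega>)\<bar> \<le> 4 * B" if "\<omega> \<in> space M" for \<omega>
      using d[OF that, of n k] by (auto simp: indicator_def abs_mult B0)
    have j: "integrable M (\<lambda>\<omega>. 2 * indicator H \<omega> * (X n \<omega> - X k \<omega>) * (X m \<omega> - X n \<omega>))"
    proof (rule int[of _ "(4 * B) * (2 * B)"])
      fix \<omega> assume "\<omega> \<in> space M"
      from mult_mono[OF Zb[OF this] d[OF this]]
      show "\<bar>2 * indicator H \<omega> * (X n \<omega> - X k \<omega>) * (X m \<omega> - X n \<omega>)\<bar> \<le> (4 * B) * (2 * B)"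
        by (simp add: abs_mult B0)
    qed auto
    have "(\<integral>\<omega>. indicator H \<omega> * (X m \<omega> - X k \<omega>)\<^sup>2 \<partial>M) =
       (\<integral>\<omega>. indicator H \<omega> * (X m \<omega> - X n \<omega>)\<^sup>2 + indicator H \<omega> * (X n \<omega> - X k \<omega>)\<^sup>2
          + 2 * indicator H \<omega> * (X n \<omega> - X k \<omega>) * (X m \<omega> - X n \<omega>) \<partial>M)"
      by (intro Bochner_Integration.integral_cong) (auto simp: power2_eq_square algebra_simps)
    also have "\<dots> = (\<integral>\<omega>. indicator H \<omega> * (X m \<omega> - X n \<omega>)\<^sup>2 \<partial>M) + (\<integral>\<omega>. indicator H \<omega> * (X n \<omega> - X k \<omega>)\<^sup>2 \<partial>M)"
      using orth[OF Z Zb nm] by (simp add: i j)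
    finally show ?thesis .
  qed
  \<comment> \<open>\<open>b\<close> is the energy of the martingale. By \<open>sq\<close> it is
    additive over increments, hence increasing, and the uniform bound makes it converge. The
    remaining energy \<open>L - b k\<close> then controls all oscillation after time
    \<open>k\<close>, which yields the Cauchy property.\<close>
  define a where "a k n = (\<integral>\<omega>. (X n \<omega> - X k \<omega>)\<^sup>2 \<partial>M)" for k n
  define b where "b n = a 0 n" for n
  have spaceF: "space M \<in> sets (F n)" for n using spF[of n] sets.top[of "F n"] by auto
  have a: "a k n = b n - b k" if "k \<le> n" for k n
  proof -
    have "(\<integral>\<omega>. indicator (space M) \<omega> * (X i \<omega> - X j \<omega>)\<^sup>2 \<partial>M) = (\<integral>\<omega>. (X i \<omega> - X j \<omega>)\<^sup>2 \<partial>M)" for i j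
      by (intro Bochner_Integration.integral_cong) auto
    then show ?thesis
      using sq[OF spaceF, of 0 k n] that by (auto simp: a_def b_def)
  qed
  have bb: "b n \<le> (2 * B)\<^sup>2" for n
  proof -
    have "b n \<le> (\<integral>\<omega>. (2 * B)\<^sup>2 \<partial>M)"
      unfolding b_def a_def
      by (intro integral_mono int[of _ "(2*B)\<^sup>2"]) (use d2 in \<open>auto simp: abs_of_nonneg\<close>)
    then show ?thesis by (simp add: prob_space)
  qed
  have "incseq b"
  proof (rule monoI)
    fix m n :: nat assume "m \<le> n"
    have "0 \<le> a m n" unfolding a_def by simp
    then show "b m \<le> b n" using a[OF \<open>m \<le> n\<close>] by simp
  qed
  then obtain L where L: "b \<longlonglongrightarrow> L" and bL: "\<And>n. b n \<le> L"
    using incseq_convergent[of b] bb by blast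
  \<comment> \<open>Kolmogorov's maximal inequality, by backward induction on the first index; localising to
    an event of the current sigma-algebra replaces the usual first-exit decomposition.\<close>
  have maximal: "e\<^sup>2 * measure M {\<omega> \<in> H. \<exists>i\<in>{j..N}. e < \<bar>X i \<omega> - X k \<omega>\<bar>}
      \<le> (\<integral>\<omega>. indicator H \<omega> * (X N \<omega> - X k \<omega>)\<^sup>2 \<partial>M)"
    if "k \<le> j" "j \<le> N" "H \<in> sets (F j)" "0 < e" for e j N k H
    using \<open>j \<le> N\<close> \<open>k \<le> j\<close> \<open>H \<in> sets (F j)\<close>
  proof (induction arbitrary: H rule: inc_induct)
    case base
    define G where "G = {\<omega> \<in> H. e < \<bar>X N \<omega> - X k \<omega>\<bar>}"
    have [measurable]: "H \<in> sets M" using setsM[OF base(2)] .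
    have "G = {\<omega> \<in> space M. \<omega> \<in> H \<and> e < \<bar>X N \<omega> - X k \<omega>\<bar>}"
      using sets.sets_into_space[of H M] by (auto simp: G_def)
    also have "\<dots> \<in> sets M" by measurable
    finally have GM: "G \<in> sets M" .
    have "e\<^sup>2 * measure M G \<le> (\<integral>\<omega>. indicator H \<omega> * (X N \<omega> - X k \<omega>)\<^sup>2 \<partial>M)"
      by (rule chebyshev[OF GM \<open>H \<in> sets M\<close> _ _ \<open>0 < e\<close>]) (auto simp: G_def)
    then show ?case by (simp add: G_def)
  next
    case (step j)
    \<comment> \<open>On \<open>H1\<close> the level is exceeded at time \<open>j\<close> itself,
      and \<open>sq\<close> lifts the energy from \<open>j\<close> to \<open>N\<close> at the cost
      of a nonnegative term. On \<open>H2\<close> it is not exceeded at \<open>j\<close>, so only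
      later times count and the induction hypothesis applies; this is why \<open>H2\<close> must lie
      in \<open>F (Suc j)\<close>.\<close>
    define H1 where "H1 = {\<omega> \<in> H. e < \<bar>X j \<omega> - X k \<omega>\<bar>}"
    define H2 where "H2 = H - H1"
    have HM[measurable]: "H \<in> sets M" using setsM step.prems by blast
    have Hsp: "H \<subseteq> space M" using sets.sets_into_space[OF HM] .
    have "H1 = {\<omega> \<in> space (F j). \<omega> \<in> H \<and> e < \<bar>X j \<omega> - X k \<omega>\<bar>}" using Hsp by (auto simp: H1_def spF)
    also have "\<dots> \<in> sets (F j)" using X[of j] XF[of k j] step.prems by measurable
    finally have H1: "H1 \<in> sets (F j)" .
    have H1M[measurable]: "H1 \<in> sets M" using setsM[OF H1] .
    have H2: "H2 \<in> sets (F (Suc j))" using H1 step.prems mono[of j] by (auto simp: H2_def)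
    have H2M[measurable]: "H2 \<in> sets M" using setsM[OF H2] .
    define E where "E = {\<omega> \<in> H2. \<exists>i\<in>{Suc j..N}. e < \<bar>X i \<omega> - X k \<omega>\<bar>}"
    have "E = {\<omega> \<in> space M. \<omega> \<in> H2 \<and> (\<exists>i\<in>{Suc j..N}. e < \<bar>X i \<omega> - X k \<omega>\<bar>)}"
      using Hsp by (auto simp: E_def H2_def)
    also have "\<dots> \<in> sets M" by measurable
    finally have EM[measurable]: "E \<in> sets M" .
    have eq: "{\<omega> \<in> H. \<exists>i\<in>{j..N}. e < \<bar>X i \<omega> - X k \<omega>\<bar>} = H1 \<union> E"
    proof -
      have "{j..N} = insert j {Suc j..N}" using step.hyps by auto
      then show ?thesis unfolding E_def H2_def H1_def by auto
    qed
    have disj: "H1 \<inter> E = {}" by (auto simp: E_def H2_def)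
    have hj: "e\<^sup>2 * measure M H1 \<le> (\<integral>\<omega>. indicator H1 \<omega> * (X j \<omega> - X k \<omega>)\<^sup>2 \<partial>M)"
      by (rule chebyshev[OF H1M H1M _ _ \<open>0 < e\<close>]) (auto simp: H1_def)
    have "0 \<le> (\<integral>\<omega>. indicator H1 \<omega> * (X N \<omega> - X j \<omega>)\<^sup>2 \<partial>M)" by simp
    then have h1: "e\<^sup>2 * measure M H1 \<le> (\<integral>\<omega>. indicator H1 \<omega> * (X N \<omega> - X k \<omega>)\<^sup>2 \<partial>M)"
      using hj sq[OF H1, of k N] step.prems step.hyps by linarith
    have h2: "e\<^sup>2 * measure M E \<le> (\<integral>\<omega>. indicator H2 \<omega> * (X N \<omega> - X k \<omega>)\<^sup>2 \<partial>M)"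
      unfolding E_def using step H2 by simp
    have "(\<integral>\<omega>. indicator H \<omega> * (X N \<omega> - X k \<omega>)\<^sup>2 \<partial>M)
        = (\<integral>\<omega>. indicator H1 \<omega> * (X N \<omega> - X k \<omega>)\<^sup>2 + indicator H2 \<omega> * (X N \<omega> - X k \<omega>)\<^sup>2 \<partial>M)"
      by (intro Bochner_Integration.integral_cong) (auto simp: H2_def H1_def indicator_def)
    also have "\<dots> = (\<integral>\<omega>. indicator H1 \<omega> * (X N \<omega> - X k \<omega>)\<^sup>2 \<partial>M) + (\<integral>\<omega>. indicator H2 \<omega> * (X N \<omega> - X k \<omega>)\<^sup>2 \<partial>M)"
      by (rule Bochner_Integration.integral_add) (auto intro!: i)
    finally show ?case
      unfolding eq using h1 h2 finite_measure_Union[OF H1M EM disj] by (simp add: distrib_left)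
  qed
  have tail: "e\<^sup>2 * prob {\<omega>\<in>space M. \<exists>i\<ge>k. e < \<bar>X i \<omega> - X k \<omega>\<bar>} \<le> L - b k" if e: "0 < e" for e k
  proof -
    \<comment> \<open>\<open>maximal\<close> has a finite horizon; continuity from below along the
      increasing events \<open>E N\<close> removes it.\<close>
    define E where "E N = {\<omega>\<in>space M. \<exists>i\<in>{k..N + k}. e < \<bar>X i \<omega> - X k \<omega>\<bar>}" for N
    have "range E \<subseteq> sets M" unfolding E_def by auto
    moreover have "incseq E" unfolding E_def incseq_def by force
    ultimately have lim: "(\<lambda>N. e\<^sup>2 * prob (E N)) \<longlonglongrightarrow> e\<^sup>2 * prob (\<Union>N. E N)"
      by (intro tendsto_mult_left finite_Lim_measure_incseq)
    have U: "(\<Union>N. E N) = {\<omega>\<in>space M. \<exists>i\<ge>k. e < \<bar>X i \<omega> - X k \<omega>\<bar>}"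
    proof (intro set_eqI iffI)
      fix \<omega> assume "\<omega> \<in> {\<omega>\<in>space M. \<exists>i\<ge>k. e < \<bar>X i \<omega> - X k \<omega>\<bar>}"
      then obtain i where "\<omega> \<in> space M" "k \<le> i" "e < \<bar>X i \<omega> - X k \<omega>\<bar>" by blast
      then have "\<omega> \<in> E i" unfolding E_def by auto
      then show "\<omega> \<in> (\<Union>N. E N)" by blast
    qed (auto simp: E_def)
    have "e\<^sup>2 * prob (E N) \<le> L - b k" for N
    proof -
      have "e\<^sup>2 * prob (E N) \<le> (\<integral>\<omega>. indicator (space M) \<omega> * (X (N + k) \<omega> - X k \<omega>)\<^sup>2 \<partial>M)"
        unfolding E_def using maximal[of k k "N + k", OF _ _ spaceF e] by simp
      also have "\<dots> = a k (N + k)"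
        unfolding a_def by (intro Bochner_Integration.integral_cong) auto
      finally show ?thesis using a[of k "N + k"] bL[of "N + k"] by simp
    qed
    then show ?thesis using LIMSEQ_le_const2[OF lim] U by auto
  qed
  have osc: "AE \<omega> in M. \<exists>k. \<forall>i\<ge>k. \<bar>X i \<omega> - X k \<omega>\<bar> \<le> e" if e: "0 < e" for e
  proof -
    define E where "E = {\<omega>\<in>space M. \<forall>k. \<exists>i\<ge>k. e < \<bar>X i \<omega> - X k \<omega>\<bar>}"
    have [measurable]: "E \<in> sets M" unfolding E_def by measurable
    have "e\<^sup>2 * prob E \<le> L - b k" for k
    proof -
      have "prob E \<le> prob {\<omega>\<in>space M. \<exists>i\<ge>k. e < \<bar>X i \<omega> - X k \<omega>\<bar>}"
        by (intro finite_measure_mono) (auto simp: E_def)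
      then have "e\<^sup>2 * prob E \<le> e\<^sup>2 * prob {\<omega>\<in>space M. \<exists>i\<ge>k. e < \<bar>X i \<omega> - X k \<omega>\<bar>}"
        by (intro mult_left_mono) auto
      then show ?thesis using tail[OF e, of k] by linarith
    qed
    moreover have "(\<lambda>k. L - b k) \<longlonglongrightarrow> L - L" by (intro tendsto_intros L)
    ultimately have "e\<^sup>2 * prob E \<le> 0" using LIMSEQ_le_const[of "\<lambda>k. L - b k"] by auto
    then have "prob E = 0" using e by (simp add: mult_le_0_iff measure_le_0_iff)
    then have "AE \<omega> in M. \<omega> \<notin> E" using prob_eq_0 by auto
    with AE_space show ?thesis by eventually_elim (auto simp: E_def not_less)
  qed
  have "AE \<omega> in M. \<forall>l::nat. \<exists>k. \<forall>i\<ge>k. \<bar>X i \<omega> - X k \<omega>\<bar> \<le> 1 / Suc l"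
    using osc by (subst AE_all_countable) auto
  then show ?thesis
  proof eventually_elim
    fix \<omega> assume *: "\<forall>l::nat. \<exists>k. \<forall>i\<ge>k. \<bar>X i \<omega> - X k \<omega>\<bar> \<le> 1 / Suc l"
    have "Cauchy (\<lambda>n. X n \<omega>)"
    proof (rule CauchyI')
      fix e :: real assume "0 < e"
      then obtain l where l: "1 / Suc l < e / 2" using reals_Archimedean[of "e / 2"] by (auto simp: inverse_eq_divide)
      obtain k where k: "\<And>i. k \<le> i \<Longrightarrow> \<bar>X i \<omega> - X k \<omega>\<bar> \<le> 1 / Suc l" using * by metis
      have "dist (X m \<omega>) (X n \<omega>) < e" if "k \<le> m" "m < n" for m n
        using k[of m] k[of n] that l unfolding dist_real_def by linarith
      then show "\<exists>k. \<forall>m\<ge>k. \<forall>n>m. dist (X m \<omega>) (X n \<omega>) < e" by blast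
    qed
    then show "convergent (\<lambda>n. X n \<omega>)" by (rule Cauchy_convergent)
  qed
qed

section \<open>Shift, ergodicity and independence\<close>

text \<open>Sums over states are written as integrals over counting measure, so that they commute
  with expectations without summability conditions. Countability of the index turns measurability of
  each term into joint measurability.\<close>

lemma borel_measurable_nn_integral_count_space:
  fixes f :: "'a \<Rightarrow> 'i :: countable \<Rightarrow> ennreal"
  assumes [measurable]: "\<And>i. (\<lambda>\<omega>. f \<omega> i) \<in> borel_measurable N"
  shows "(\<lambda>\<omega>. \<integral>\<^sup>+i. f \<omega> i \<partial>count_space UNIV) \<in> borel_measurable N"
proof -
  interpret sigma_finite_measure "count_space (UNIV :: 'i set)"
    by (rule sigma_finite_measure_count_space_countable) auto
  have [measurable]: "(\<lambda>p. f (snd p) (fst p)) \<in> borel_measurable (count_space UNIV \<Otimes>\<^sub>M N)"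
    by (rule measurable_pair_measure_countable1) auto
  have "(\<lambda>(\<omega>, i). f \<omega> i) = (\<lambda>p. f (snd p) (fst p)) \<circ> (\<lambda>(\<omega>, i). (i, \<omega>))"
    by (auto simp: fun_eq_iff)
  moreover have "\<dots> \<in> borel_measurable (N \<Otimes>\<^sub>M count_space UNIV)"
    by (rule measurable_comp[OF measurable_pair_swap']) measurable
  ultimately show ?thesis by (intro borel_measurable_nn_integral) simp
qed

lemma nn_integral_count_space_swap:
  fixes f :: "'a :: countable \<Rightarrow> 'b :: countable \<Rightarrow> ennreal"
  shows "(\<integral>\<^sup>+x. \<integral>\<^sup>+y. f x y \<partial>count_space UNIV \<partial>count_space UNIV)
    = (\<integral>\<^sup>+y. \<integral>\<^sup>+x. f x y \<partial>count_space UNIV \<partial>count_space UNIV)"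
  by (rule nn_integral_count_space_nn_integral) auto

text \<open>Summing over an intermediate state \<open>z\<close> that is forced to equal
  \<open>a\<close>: this inserts or removes a state in the middle of a path.\<close>

lemma nn_integral_count_space_singleton:
  fixes g :: "'a \<Rightarrow> ennreal"
  shows "(\<integral>\<^sup>+z. indicator {z} a * g z \<partial>count_space UNIV) = g a"
proof -
  have "(\<integral>\<^sup>+z. indicator {z} a * g z \<partial>count_space UNIV) = (\<integral>\<^sup>+z. g z * indicator {a} z \<partial>count_space UNIV)"
    by (intro nn_integral_cong) (auto simp: indicator_def)
  also have "\<dots> = g a" by (subst nn_integral_indicator_singleton) auto
  finally show ?thesis .
qed

text \<open>Independence passes down from \<open>F\<close> and \<open>G\<close> to the smaller
  sigma-algebras generated by \<open>f\<close> and \<open>g\<close>, so the two functions are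
  independent random variables and their product integrates to the product of the means.\<close>

lemma (in prob_space) indep_set_nn_integral_mult:
  fixes f g :: "'a \<Rightarrow> ennreal"
  assumes F: "subalgebra M F" and G: "subalgebra M G"
    and indep: "indep_set (sets F) (sets G)"
    and f: "f \<in> borel_measurable F" and g: "g \<in> borel_measurable G"
  shows "(\<integral>\<^sup>+\<omega>. f \<omega> * g \<omega> \<partial>M) = (\<integral>\<^sup>+\<omega>. f \<omega> \<partial>M) * (\<integral>\<^sup>+\<omega>. g \<omega> \<partial>M)"
proof -
  have sp: "space F = space M" "space G = space M" using F G by (auto simp: subalgebra_def)
  have s: "sigma_sets (space M) {u -` A \<inter> space M | A. A \<in> sets borel} \<subseteq> sets K"
    if "u \<in> borel_measurable K" "space K = space M" for u :: "'a \<Rightarrow> ennreal" and K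
    unfolding that(2)[symmetric] using measurable_sets[OF that(1)] by (intro sets.sigma_sets_subset) auto
  have "indep_var borel f borel g"
    unfolding indep_var_eq
  proof (intro conjI)
    show "indep_set (sigma_sets (space M) {f -` A \<inter> space M |A. A \<in> sets borel})
       (sigma_sets (space M) {g -` A \<inter> space M |A. A \<in> sets borel})"
      using indep s[OF f sp(1)] s[OF g sp(2)] unfolding indep_set_def
      by (elim indep_sets_mono_sets) (auto split: bool.split)
  qed (use measurable_from_subalg[OF F f] measurable_from_subalg[OF G g] in auto)
  moreover have "case_bool borel borel = (\<lambda>_. borel :: ennreal measure)" by (auto split: bool.split)
  ultimately have "indep_vars (\<lambda>_. borel) (case_bool f g) UNIV"
    unfolding indep_var_def by simp
  from indep_vars_nn_integral[OF _ this] show ?thesis by (simp add: UNIV_bool mult.commute)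
qed

context rds
begin

lemma theta_space: "\<omega> \<in> space M \<Longrightarrow> \<theta> n \<omega> \<in> space M"
  using measurable_space[OF theta_measurable] .

lemma theta_minus [simp]:
  assumes "\<omega> \<in> space M"
  shows "\<theta> (- n) (\<theta> n \<omega>) = \<omega>" "\<theta> n (\<theta> (- n) \<omega>) = \<omega>"
  using theta_add[OF assms, of "-n" n] theta_add[OF assms, of n "-n"] theta_zero[OF assms] by auto

lemma phi_point_measurable: "(\<lambda>\<omega>. \<phi> n \<omega> x) \<in> M \<rightarrow>\<^sub>M count_space UNIV"
proof -
  have "(\<lambda>\<omega>. (\<omega>, n, x)) \<in> M \<rightarrow>\<^sub>M M \<Otimes>\<^sub>M (count_space UNIV \<Otimes>\<^sub>M count_space UNIV)"
    by (intro measurable_Pair) auto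
  from measurable_compose[OF this phi_measurable] show ?thesis by simp
qed

lemmas [measurable] = theta_measurable phi_point_measurable

lemma nn_integral_theta:
  assumes "f \<in> borel_measurable M"
  shows "(\<integral>\<^sup>+\<omega>. f (\<theta> n \<omega>) \<partial>M) = (\<integral>\<^sup>+\<omega>. f \<omega> \<partial>M)"
  using nn_integral_distr[OF theta_measurable, of f n] assms
  unfolding theta_measure_preserving by simp

lemma AE_theta:
  assumes "AE \<omega> in M. P \<omega>"
  shows "AE \<omega> in M. P (\<theta> n \<omega>)"
  by (rule AE_distrD[OF theta_measurable]) (subst theta_measure_preserving, rule assms)

lemma prob_theta:
  assumes [measurable]: "{\<omega>\<in>space M. P \<omega>} \<in> sets M"
  shows "\<P>(\<omega> in M. P (\<theta> n \<omega>)) = \<P>(\<omega> in M. P \<omega>)"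
proof -
  have "measure M {\<omega>\<in>space M. P \<omega>} = measure (distr M M (\<theta> n)) {\<omega>\<in>space M. P \<omega>}"
    by (simp add: theta_measure_preserving)
  also have "\<dots> = measure M (\<theta> n -` {\<omega>\<in>space M. P \<omega>} \<inter> space M)"
    by (rule measure_distr) auto
  also have "\<theta> n -` {\<omega>\<in>space M. P \<omega>} \<inter> space M = {\<omega>\<in>space M. P (\<theta> n \<omega>)}"
    using theta_space by auto
  finally show ?thesis by simp
qed

text \<open>Measure preservation turns inclusion into equality: \<open>E\<close> lies in its
  preimage \<open>D\<close> up to a null set and both have the same probability. The ergodicity
  assumption speaks of strictly invariant sets only, so \<open>E\<close> still has to be modified on
  a null set.\<close>

lemma ergodic_subinvariant_set:
  assumes E[measurable]: "E \<in> sets M" and sub: "AE \<omega> in M. \<omega> \<in> E \<longrightarrow> \<theta> 1 \<omega> \<in> E"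
  shows "prob E = 0 \<or> prob E = 1"
proof -
  define D where "D = {\<omega>\<in>space M. \<theta> 1 \<omega> \<in> E}"
  have D[measurable]: "D \<in> sets M" unfolding D_def by measurable
  have "prob D = prob E"
    using prob_theta[of "\<lambda>\<omega>. \<omega> \<in> E" 1] sets.sets_into_space[OF E] by (simp add: D_def Int_absorb1 Collect_conj_eq)
  have "AE \<omega> in M. \<omega> \<in> E \<inter> D \<longleftrightarrow> \<omega> \<in> E"
    using sub AE_space by eventually_elim (auto simp: D_def)
  then have "prob (E \<inter> D) = prob E" by (intro finite_measure_eq_AE) auto
  then have "prob (D - E \<inter> D) = 0"
    using finite_measure_Diff[of D "E \<inter> D"] \<open>prob D = prob E\<close> by auto
  then have "AE \<omega> in M. \<omega> \<notin> D - E \<inter> D" by (intro prob_eq_0[THEN iffD1]) auto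
  with sub AE_space have inv: "AE \<omega> in M. \<omega> \<in> E \<longleftrightarrow> \<theta> 1 \<omega> \<in> E"
    by eventually_elim (auto simp: D_def)
  have "AE \<omega> in M. \<forall>n. \<theta> n \<omega> \<in> E \<longleftrightarrow> \<theta> 1 (\<theta> n \<omega>) \<in> E"
    by (subst AE_all_countable) (intro allI AE_theta inv)
  with AE_space have const: "AE \<omega> in M. \<forall>n. \<theta> n \<omega> \<in> E \<longleftrightarrow> \<omega> \<in> E"
  proof eventually_elim
    fix \<omega> assume \<omega>: "\<omega> \<in> space M" and *: "\<forall>n. \<theta> n \<omega> \<in> E \<longleftrightarrow> \<theta> 1 (\<theta> n \<omega>) \<in> E"
    have step: "\<theta> n \<omega> \<in> E \<longleftrightarrow> \<theta> (1 + n) \<omega> \<in> E" for n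
      using * theta_add[OF \<omega>, of 1 n] by simp
    show "\<forall>n. \<theta> n \<omega> \<in> E \<longleftrightarrow> \<omega> \<in> E"
    proof
      fix n show "\<theta> n \<omega> \<in> E \<longleftrightarrow> \<omega> \<in> E"
      proof (induction n rule: int_induct[where k=0])
        case base then show ?case using theta_zero[OF \<omega>] by simp
      next
        case (step1 i) then show ?case using step[of i] by (simp add: add.commute)
      next
        case (step2 i) then show ?case using step[of "i - 1"] by simp
      qed
    qed
  qed
  \<comment> \<open>Quantifying over all integers, and not only over the forward orbit, makes
    \<open>E'\<close> equal to its own preimage.\<close>
  define E' where "E' = {\<omega>\<in>space M. \<forall>n. \<theta> n \<omega> \<in> E}"
  have [measurable]: "E' \<in> sets M" unfolding E'_def by measurable
  have "\<theta> 1 -` E' \<inter> space M = E'"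
  proof (intro set_eqI iffI)
    fix \<omega> assume "\<omega> \<in> \<theta> 1 -` E' \<inter> space M"
    then have \<omega>: "\<omega> \<in> space M" and *: "\<And>n. \<theta> n (\<theta> 1 \<omega>) \<in> E" by (auto simp: E'_def)
    have "\<theta> n \<omega> \<in> E" for n using *[of "n - 1"] theta_add[OF \<omega>, of "n - 1" 1] by simp
    then show "\<omega> \<in> E'" using \<omega> by (simp add: E'_def)
  next
    fix \<omega> assume "\<omega> \<in> E'"
    then have \<omega>: "\<omega> \<in> space M" and *: "\<And>n. \<theta> n \<omega> \<in> E" by (auto simp: E'_def)
    have "\<theta> n (\<theta> 1 \<omega>) \<in> E" for n using *[of "n + 1"] theta_add[OF \<omega>, of n 1] by simp
    then show "\<omega> \<in> \<theta> 1 -` E' \<inter> space M" using \<omega> theta_space[OF \<omega>] by (simp add: E'_def)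
  qed
  then have "prob E' = 0 \<or> prob E' = 1" by (intro theta_ergodic) auto
  moreover have "prob E' = prob E"
  proof (rule finite_measure_eq_AE)
    show "AE \<omega> in M. \<omega> \<in> E' \<longleftrightarrow> \<omega> \<in> E" using const AE_space by eventually_elim (auto simp: E'_def)
  qed auto
  ultimately show ?thesis by simp
qed

text \<open>Superlevel sets of \<open>g\<close> are carried into themselves by the shift, so they
  have probability 0 or 1. Choosing the mean as level decides which: \<open>g\<close> can be neither
  almost surely above nor almost surely below its own mean.\<close>

lemma ergodic_mono_AE_const:
  fixes g :: "'w \<Rightarrow> real"
  assumes g: "integrable M g" and mono: "AE \<omega> in M. g \<omega> \<le> g (\<theta> 1 \<omega>)"
  shows "AE \<omega> in M. g \<omega> = expectation g"
proof -
  define c where "c = expectation g"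
  have [measurable]: "g \<in> borel_measurable M" using g by auto
  have E: "prob {\<omega>\<in>space M. g \<omega> > c} = 0 \<or> prob {\<omega>\<in>space M. g \<omega> > c} = 1"
  proof (rule ergodic_subinvariant_set)
    show "AE \<omega> in M. \<omega> \<in> {\<omega>\<in>space M. g \<omega> > c} \<longrightarrow> \<theta> 1 \<omega> \<in> {\<omega>\<in>space M. g \<omega> > c}"
      using mono AE_space by eventually_elim (auto simp: theta_space)
  qed auto
  have E': "prob {\<omega>\<in>space M. g \<omega> \<ge> c} = 0 \<or> prob {\<omega>\<in>space M. g \<omega> \<ge> c} = 1"
  proof (rule ergodic_subinvariant_set)
    show "AE \<omega> in M. \<omega> \<in> {\<omega>\<in>space M. g \<omega> \<ge> c} \<longrightarrow> \<theta> 1 \<omega> \<in> {\<omega>\<in>space M. g \<omega> \<ge> c}"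
      using mono AE_space by eventually_elim (auto simp: theta_space)
  qed auto
  have "\<not> (AE \<omega> in M. c < g \<omega>)"
  proof
    assume "AE \<omega> in M. c < g \<omega>"
    then have "expectation (\<lambda>_. c) < expectation g"
      by (intro integral_less_AE_space) (auto simp: g emeasure_space_1)
    then show False by (simp add: c_def prob_space)
  qed
  then have 1: "AE \<omega> in M. \<not> g \<omega> > c"
    using E by (auto simp: prob_Collect_eq_1 prob_Collect_eq_0)
  have "\<not> (AE \<omega> in M. \<not> c \<le> g \<omega>)"
  proof
    assume "AE \<omega> in M. \<not> c \<le> g \<omega>"
    then have "AE \<omega> in M. g \<omega> < c" by auto
    then have "expectation g < expectation (\<lambda>_. c)"
      by (intro integral_less_AE_space) (auto simp: g emeasure_space_1)
    then show False by (simp add: c_def prob_space)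
  qed
  then have "AE \<omega> in M. g \<omega> \<ge> c"
    using E' by (auto simp: prob_Collect_eq_1 prob_Collect_eq_0)
  with 1 show ?thesis unfolding c_def by eventually_elim auto
qed

section \<open>Sigma-algebras of the past and of the future\<close>

lemma window_algebra_sets: "sets (window_algebra s t) \<subseteq> sets M"
proof -
  let ?G = "null_sets M \<union> {(\<lambda>\<omega>. \<phi> n (\<theta> m \<omega>) x) -` S \<inter> space M | x m n S. s \<le> m \<and> m + int n \<le> t}"
  have G: "?G \<subseteq> sets M"
    by (auto simp: null_sets_def intro!: measurable_sets[of _ M "count_space UNIV"])
  then have "?G \<subseteq> Pow (space M)" using sets.space_closed by (rule order_trans)
  then have "sets (window_algebra s t) = sigma_sets (space M) ?G"
    unfolding window_algebra_def by (rule sets_measure_of)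
  then show ?thesis using sets.sigma_sets_subset[OF G] by simp
qed

lemma window_algebra_generator:
  assumes "s \<le> m" "m + int n \<le> t"
  shows "{\<omega>\<in>space M. \<phi> n (\<theta> m \<omega>) x = y} \<in> sets (window_algebra s t)"
proof -
  let ?G = "null_sets M \<union> {(\<lambda>\<omega>. \<phi> n (\<theta> m \<omega>) x) -` S \<inter> space M | x m n S. s \<le> m \<and> m + int n \<le> t}"
  have "{\<omega>\<in>space M. \<phi> n (\<theta> m \<omega>) x = y} = (\<lambda>\<omega>. \<phi> n (\<theta> m \<omega>) x) -` {y} \<inter> space M" by auto
  then have "{\<omega>\<in>space M. \<phi> n (\<theta> m \<omega>) x = y} \<in> ?G" using assms by blast
  moreover have "?G \<subseteq> Pow (space M)" using sets.sets_into_space by (fastforce simp: null_sets_def)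
  ultimately show ?thesis unfolding window_algebra_def by (simp add: sets_measure_of)
qed

lemma subalgebra_past: "subalgebra M (past_algebra t)"
  and past_algebra_generator:
    "s < t \<Longrightarrow> s \<le> m \<Longrightarrow> m + int n \<le> t \<Longrightarrow> {\<omega>\<in>space M. \<phi> n (\<theta> m \<omega>) x = y} \<in> sets (past_algebra t)"
proof -
  have *: "(\<Union>s\<in>{..<t}. sets (window_algebra s t)) \<subseteq> sets M" using window_algebra_sets by blast
  then have **: "(\<Union>s\<in>{..<t}. sets (window_algebra s t)) \<subseteq> Pow (space M)" using sets.space_closed by auto
  show "subalgebra M (past_algebra t)"
    unfolding subalgebra_def past_algebra_def using * **
    by (simp add: sets_measure_of sets.sigma_sets_subset)
  show "{\<omega>\<in>space M. \<phi> n (\<theta> m \<omega>) x = y} \<in> sets (past_algebra t)" if "s < t" "s \<le> m" "m + int n \<le> t"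
    unfolding past_algebra_def using ** window_algebra_generator[OF that(2,3)] that(1)
    by (auto simp: sets_measure_of intro!: sigma_sets.Basic)
qed

lemma subalgebra_future: "subalgebra M (future_algebra s)"
  and future_algebra_generator:
    "s \<le> m \<Longrightarrow> {\<omega>\<in>space M. \<phi> n (\<theta> m \<omega>) x = y} \<in> sets (future_algebra s)"
proof -
  have *: "(\<Union>t\<in>{s<..}. sets (window_algebra s t)) \<subseteq> sets M" using window_algebra_sets by blast
  then have **: "(\<Union>t\<in>{s<..}. sets (window_algebra s t)) \<subseteq> Pow (space M)" using sets.space_closed by auto
  show "subalgebra M (future_algebra s)"
    unfolding subalgebra_def future_algebra_def using * **
    by (simp add: sets_measure_of sets.sigma_sets_subset)
  show "{\<omega>\<in>space M. \<phi> n (\<theta> m \<omega>) x = y} \<in> sets (future_algebra s)" if "s \<le> m"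
    \<comment> \<open>The window must end strictly after \<open>s\<close>; the extra 1 secures this
      also when \<open>n = 0\<close> and \<open>m = s\<close>.\<close>
    unfolding future_algebra_def using ** window_algebra_generator[OF that, of n "m + int n + 1" x y] that
    by (auto simp: sets_measure_of intro!: sigma_sets.Basic bexI[of _ "m + int n + 1"])
qed

end

section \<open>Transport of mass from the past\<close>

text \<open>The difference has integral 0, and counting measure has no nonempty null set, so
  equality holds at every point and not just almost everywhere. Finiteness of the total is what
  permits the subtraction.\<close>

lemma nn_integral_count_space_eqD:
  fixes f g :: "'a \<Rightarrow> ennreal"
  assumes le: "\<And>x. f x \<le> g x"
    and ge: "(\<integral>\<^sup>+x. g x \<partial>count_space UNIV) \<le> (\<integral>\<^sup>+x. f x \<partial>count_space UNIV)"
    and fin: "(\<integral>\<^sup>+x. f x \<partial>count_space UNIV) < \<infinity>"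
  shows "f x = g x"
proof -
  have "(\<integral>\<^sup>+x. g x - f x \<partial>count_space UNIV) = (\<integral>\<^sup>+x. g x \<partial>count_space UNIV) - (\<integral>\<^sup>+x. f x \<partial>count_space UNIV)"
    using fin by (intro nn_integral_diff) (auto simp: le)
  also have "\<dots> = 0" using ge fin by (intro diff_eq_0_ennreal) auto
  finally have "g x - f x = 0" for x
    by (simp add: nn_integral_0_iff_AE AE_count_space)
  then show ?thesis using le[of x] by (metis antisym diff_eq_0_iff_ennreal le_neq_trans ennreal_minus_eq_0)
qed

lemma nn_integral_count_space_ge:
  fixes f :: "'a \<Rightarrow> ennreal"
  shows "f x \<le> (\<integral>\<^sup>+x. f x \<partial>count_space UNIV)"
proof -
  have "f x = (\<integral>\<^sup>+z. f z * indicator {x} z \<partial>count_space UNIV)"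
    by (subst nn_integral_indicator_singleton) auto
  also have "\<dots> \<le> (\<integral>\<^sup>+z. f z \<partial>count_space UNIV)"
    by (intro nn_integral_mono) (auto simp: indicator_def)
  finally show ?thesis .
qed

text \<open>\<open>K\<close> is separate from \<open>N\<close> so that \<open>N\<close> can be a
  sub-sigma-algebra while the events remain written over \<open>space M\<close>.\<close>

lemma borel_measurable_indicator_singleton:
  assumes "space N = space K" "{\<omega>\<in>space K. a \<omega> = y} \<in> sets N"
  shows "(\<lambda>\<omega>. indicator {y} (a \<omega>) :: ennreal) \<in> borel_measurable N"
proof -
  have "(\<lambda>\<omega>. indicator {\<omega>\<in>space K. a \<omega> = y} \<omega> :: ennreal) \<in> borel_measurable N"
    using assms by (intro borel_measurable_indicator)
  then show ?thesis by (rule measurable_cong[THEN iffD1, rotated]) (auto simp: assms indicator_def)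
qed

context rds
begin

definition step_prob :: "nat \<Rightarrow> 'x \<Rightarrow> 'x \<Rightarrow> ennreal" where
  "step_prob n x y = (\<integral>\<^sup>+\<omega>. indicator {y} (\<phi> n \<omega> x) \<partial>M)"

text \<open>No normalisation is imposed: besides \<pi> this also covers densities of total mass
  \<kappa> and the truncated difference of two densities.\<close>

definition stationary_density :: "('x \<Rightarrow> ennreal) \<Rightarrow> bool" where
  "stationary_density f \<longleftrightarrow> (\<forall>y. (\<integral>\<^sup>+x. f x * step_prob 1 x y \<partial>count_space UNIV) = f y)"

text \<open>The initial mass \<open>f\<close> is placed at time \<open>- n\<close> and moved by one
  realisation of the flow to time 0; the value is what arrives at \<open>y\<close>.\<close>

definition pullback_mass :: "('x \<Rightarrow> ennreal) \<Rightarrow> nat \<Rightarrow> 'x \<Rightarrow> 'w \<Rightarrow> ennreal" where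
  "pullback_mass f n y \<omega> =
     (\<integral>\<^sup>+x. f x * indicator {y} (\<phi> n (\<theta> (- int n) \<omega>) x) \<partial>count_space UNIV)"

text \<open>Only the maps ending at time 0 and starting no earlier than \<open>- n\<close> enter.
  Hence a shift by \<open>n\<close> makes all its events future events, which the Markov property
  separates from the past.\<close>

definition pullback_filtration :: "nat \<Rightarrow> 'w measure" where
  "pullback_filtration n =
     sigma (space M) {{\<omega>\<in>space M. \<phi> k (\<theta> (- int k) \<omega>) x = y} | k x y. k \<le> n}"

lemma step_prob_eq: "step_prob n x y = ennreal (\<P>(\<omega> in M. \<phi> n \<omega> x = y))"
proof -
  have "step_prob n x y = (\<integral>\<^sup>+\<omega>. indicator {\<omega>\<in>space M. \<phi> n \<omega> x = y} \<omega> \<partial>M)"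
    unfolding step_prob_def by (intro nn_integral_cong) (auto simp: indicator_def)
  then show ?thesis by (simp add: emeasure_eq_measure)
qed

lemma nn_integral_indicator_phi_theta:
  "(\<integral>\<^sup>+\<omega>. indicator {y} (\<phi> n (\<theta> m \<omega>) x) \<partial>M) = step_prob n x y"
  unfolding step_prob_def by (rule nn_integral_theta[of "\<lambda>\<omega>. indicator {y} (\<phi> n \<omega> x)"]) measurable

lemma sum_step_prob: "(\<integral>\<^sup>+y. step_prob n x y \<partial>count_space UNIV) = 1"
proof -
  have "(\<integral>\<^sup>+y. step_prob n x y \<partial>count_space UNIV)
      = (\<integral>\<^sup>+\<omega>. \<integral>\<^sup>+y. indicator {y} (\<phi> n \<omega> x) * 1 \<partial>count_space UNIV \<partial>M)"
    unfolding step_prob_def by (subst nn_integral_count_space_nn_integral) auto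
  also have "\<dots> = 1" by (simp only: nn_integral_count_space_singleton) (simp add: emeasure_space_1)
  finally show ?thesis .
qed

lemma phi_pullback_Suc:
  assumes "\<omega> \<in> space M"
  shows "\<phi> (Suc n) (\<theta> (- int (Suc n)) \<omega>) x = \<phi> n (\<theta> (- int n) \<omega>) (\<phi> 1 (\<theta> (- 1) (\<theta> (- int n) \<omega>)) x)"
proof -
  have 1: "\<theta> (- int (Suc n)) \<omega> = \<theta> (- 1) (\<theta> (- int n) \<omega>)"
    using theta_add[OF assms, of "- 1" "- int n"] by (simp add: algebra_simps)
  have 2: "\<theta> 1 (\<theta> (- 1) (\<theta> (- int n) \<omega>)) = \<theta> (- int n) \<omega>"
    using theta_space[OF assms] by simp
  show ?thesis unfolding 1
    using phi_cocycle[OF theta_space[OF theta_space[OF assms]], of n 1 "- 1" "- int n" x] 2 by simp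
qed

lemma nn_integral_pullback_mass: "(\<integral>\<^sup>+\<omega>. pullback_mass f n y \<omega> \<partial>M)
    = (\<integral>\<^sup>+x. f x * step_prob n x y \<partial>count_space UNIV)"
  unfolding pullback_mass_def
  by (subst nn_integral_count_space_nn_integral)
     (auto simp: nn_integral_cmult nn_integral_indicator_phi_theta)

lemma sum_pullback_mass:
  "(\<integral>\<^sup>+y. pullback_mass f n y \<omega> \<partial>count_space UNIV) = (\<integral>\<^sup>+x. f x \<partial>count_space UNIV)"
proof -
  have "(\<integral>\<^sup>+y. pullback_mass f n y \<omega> \<partial>count_space UNIV)
     = (\<integral>\<^sup>+x. \<integral>\<^sup>+y. indicator {y} (\<phi> n (\<theta> (- int n) \<omega>) x) * f x \<partial>count_space UNIV \<partial>count_space UNIV)"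
    unfolding pullback_mass_def by (subst nn_integral_count_space_swap) (simp add: mult.commute)
  also have "\<dots> = (\<integral>\<^sup>+x. f x \<partial>count_space UNIV)"
    by (simp only: nn_integral_count_space_singleton)
  finally show ?thesis .
qed

text \<open>The additional step lies at the early end of the path and acts first. Seen from time
  \<open>- n\<close>, its result is a past quantity and the remaining \<open>n\<close> steps are
  future ones.\<close>

lemma pullback_mass_Suc:
  assumes "\<omega> \<in> space M"
  shows "pullback_mass f (Suc n) y \<omega>
    = (\<integral>\<^sup>+z. pullback_mass f 1 z (\<theta> (- int n) \<omega>) * indicator {y} (\<phi> n (\<theta> (- int n) \<omega>) z) \<partial>count_space UNIV)"
proof -
  let ?v = "\<theta> (- int n) \<omega>"
  have "(\<integral>\<^sup>+z. pullback_mass f 1 z ?v * indicator {y} (\<phi> n ?v z) \<partial>count_space UNIV)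
     = (\<integral>\<^sup>+z. \<integral>\<^sup>+x. f x * indicator {z} (\<phi> 1 (\<theta> (- 1) ?v) x) * indicator {y} (\<phi> n ?v z) \<partial>count_space UNIV \<partial>count_space UNIV)"
    unfolding pullback_mass_def by (simp add: nn_integral_multc)
  also have "\<dots> = (\<integral>\<^sup>+x. \<integral>\<^sup>+z. indicator {z} (\<phi> 1 (\<theta> (- 1) ?v) x) * (f x * indicator {y} (\<phi> n ?v z)) \<partial>count_space UNIV \<partial>count_space UNIV)"
    by (subst nn_integral_count_space_swap) (simp add: mult_ac)
  also have "\<dots> = (\<integral>\<^sup>+x. f x * indicator {y} (\<phi> n ?v (\<phi> 1 (\<theta> (- 1) ?v) x)) \<partial>count_space UNIV)"
    by (simp only: nn_integral_count_space_singleton)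
  also have "\<dots> = pullback_mass f (Suc n) y \<omega>"
    unfolding pullback_mass_def phi_pullback_Suc[OF assms] ..
  finally show ?thesis by simp
qed

text \<open>Here the additional step lies at the late end: the starting time stays fixed while the
  observer moves forward by one. In the limit this becomes the relation between the masses at
  \<omega> and at \<theta> 1 \<omega>.\<close>

lemma pullback_mass_theta:
  assumes "\<omega> \<in> space M"
  shows "pullback_mass f (Suc n) y (\<theta> 1 \<omega>)
    = (\<integral>\<^sup>+z. pullback_mass f n z \<omega> * indicator {y} (\<phi> 1 \<omega> z) \<partial>count_space UNIV)"
proof -
  have "\<theta> (- int (Suc n)) (\<theta> 1 \<omega>) = \<theta> (- int n) \<omega>"
    using theta_add[OF assms, of "- int (Suc n)" 1] by simp
  moreover have "\<phi> (Suc n) (\<theta> (- int n) \<omega>) x = \<phi> 1 \<omega> (\<phi> n (\<theta> (- int n) \<omega>) x)" for x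
    using phi_cocycle[OF theta_space[OF assms], of 1 n "- int n" x] assms by simp
  ultimately have "pullback_mass f (Suc n) y (\<theta> 1 \<omega>)
     = (\<integral>\<^sup>+x. f x * indicator {y} (\<phi> 1 \<omega> (\<phi> n (\<theta> (- int n) \<omega>) x)) \<partial>count_space UNIV)"
    unfolding pullback_mass_def by simp
  also have "\<dots> = (\<integral>\<^sup>+x. \<integral>\<^sup>+z. indicator {z} (\<phi> n (\<theta> (- int n) \<omega>) x) * (f x * indicator {y} (\<phi> 1 \<omega> z)) \<partial>count_space UNIV \<partial>count_space UNIV)"
    by (simp only: nn_integral_count_space_singleton)
  also have "\<dots> = (\<integral>\<^sup>+z. \<integral>\<^sup>+x. f x * indicator {z} (\<phi> n (\<theta> (- int n) \<omega>) x) * indicator {y} (\<phi> 1 \<omega> z) \<partial>count_space UNIV \<partial>count_space UNIV)"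
    by (subst nn_integral_count_space_swap) (simp add: mult_ac)
  also have "\<dots> = (\<integral>\<^sup>+z. pullback_mass f n z \<omega> * indicator {y} (\<phi> 1 \<omega> z) \<partial>count_space UNIV)"
    unfolding pullback_mass_def by (simp add: nn_integral_multc)
  finally show ?thesis .
qed

lemma pullback_filtration_generators:
  "{{\<omega>\<in>space M. \<phi> k (\<theta> (- int k) \<omega>) x = y} | k x y. k \<le> n} \<subseteq> Pow (space M)"
  by auto

lemma pullback_filtration_generator:
  "k \<le> n \<Longrightarrow> {\<omega>\<in>space M. \<phi> k (\<theta> (- int k) \<omega>) x = y} \<in> sets (pullback_filtration n)"
  unfolding pullback_filtration_def sets_measure_of[OF pullback_filtration_generators] by blast

lemma space_pullback_filtration [simp]: "space (pullback_filtration n) = space M"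
  unfolding pullback_filtration_def by (rule space_measure_of) auto

lemma subalgebra_pullback_filtration: "subalgebra M (pullback_filtration n)"
proof -
  have "{{\<omega>\<in>space M. \<phi> k (\<theta> (- int k) \<omega>) x = y} | k x y. k \<le> n} \<subseteq> sets M" by auto
  then show ?thesis
    unfolding subalgebra_def pullback_filtration_def sets_measure_of[OF pullback_filtration_generators]
    by (simp add: sets.sigma_sets_subset space_measure_of_conv)
qed

lemma pullback_filtration_mono: "sets (pullback_filtration n) \<subseteq> sets (pullback_filtration (Suc n))"
  unfolding pullback_filtration_def sets_measure_of[OF pullback_filtration_generators]
  by (intro sigma_sets_mono') force

text \<open>A generator looks back \<open>k \<le> n\<close> steps, so after the shift its path
  starts at time \<open>n - k\<close>, which is not negative.\<close>

lemma measurable_theta_future: "\<theta> (int n) \<in> future_algebra 0 \<rightarrow>\<^sub>M pullback_filtration n"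
proof -
  have sp: "space (future_algebra 0) = space M" using subalgebra_future by (auto simp: subalgebra_def)
  show ?thesis
    unfolding pullback_filtration_def
  proof (rule measurable_measure_of[OF pullback_filtration_generators])
    fix E assume "E \<in> {{\<omega>\<in>space M. \<phi> k (\<theta> (- int k) \<omega>) x = y} | k x y. k \<le> n}"
    then obtain k x y where E: "E = {\<omega>\<in>space M. \<phi> k (\<theta> (- int k) \<omega>) x = y}" "k \<le> n" by blast
    have "\<theta> (int n) -` E \<inter> space (future_algebra 0) = {\<omega>\<in>space M. \<phi> k (\<theta> (int n - int k) \<omega>) x = y}"
      using theta_add[of _ "- int k" "int n"] by (auto simp: E sp theta_space)
    then show "\<theta> (int n) -` E \<inter> space (future_algebra 0) \<in> sets (future_algebra 0)"
      using future_algebra_generator[of 0 "int n - int k" k x y] E by simp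
  qed (auto simp: sp theta_space)
qed

lemma pullback_mass_measurable_filtration:
  "pullback_mass f n y \<in> borel_measurable (pullback_filtration n)"
  unfolding pullback_mass_def[abs_def]
  by (intro borel_measurable_nn_integral_count_space borel_measurable_times_ennreal borel_measurable_const
      borel_measurable_indicator_singleton[where K=M] pullback_filtration_generator) auto

lemma pullback_mass_measurable [measurable]: "pullback_mass f n y \<in> borel_measurable M"
  using measurable_from_subalg[OF subalgebra_pullback_filtration pullback_mass_measurable_filtration] .

lemma pullback_mass_measurable_past: "pullback_mass f n y \<in> borel_measurable (past_algebra 0)"
proof -
  have "space (past_algebra 0) = space M" using subalgebra_past by (auto simp: subalgebra_def)
  \<comment> \<open>The window must begin strictly before 0; \<open>- int n - 1\<close> does so also
    for \<open>n = 0\<close>.\<close>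
  then show ?thesis
    unfolding pullback_mass_def[abs_def]
    by (intro borel_measurable_nn_integral_count_space borel_measurable_times_ennreal borel_measurable_const
        borel_measurable_indicator_singleton[where K=M] past_algebra_generator[of "- int n - 1"]) auto
qed

end

section \<open>Independence across a time cut, and stationary densities\<close>

context markov_rds
begin

text \<open>Shifting by \<open>\<theta> n\<close> turns the mass carried at time \<open>- n\<close> into a past quantity, and everything
  after time \<open>- n\<close> into a future one, so that the Markov property applies.\<close>

lemma nn_integral_pullback_independent:
  assumes F: "\<And>x. (\<lambda>\<omega>. F \<omega> x) \<in> borel_measurable (past_algebra 0)"
    and h: "h \<in> borel_measurable (pullback_filtration n)"
    and f: "\<And>x. (\<integral>\<^sup>+\<omega>. F \<omega> x \<partial>M) = f x"
  shows "(\<integral>\<^sup>+\<omega>. h \<omega> * (\<integral>\<^sup>+x. F (\<theta> (- int n) \<omega>) x * indicator {y} (\<phi> n (\<theta> (- int n) \<omega>) x) \<partial>count_space UNIV) \<partial>M)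
    = (\<integral>\<^sup>+\<omega>. h \<omega> * pullback_mass f n y \<omega> \<partial>M)"
proof -
  \<comment> \<open>Stated for a general \<open>F\<close> because it is applied twice: to the given
    random weights, and to the deterministic weights \<open>f\<close>, which are their own mean.
    Both sides reduce to the same sum.\<close>
  have gen: "(\<integral>\<^sup>+\<omega>. h \<omega> * (\<integral>\<^sup>+x. F (\<theta> (- int n) \<omega>) x * indicator {y} (\<phi> n (\<theta> (- int n) \<omega>) x) \<partial>count_space UNIV) \<partial>M)
    = (\<integral>\<^sup>+x. (\<integral>\<^sup>+\<omega>. F \<omega> x \<partial>M) * (\<integral>\<^sup>+\<omega>. h (\<theta> (int n) \<omega>) * indicator {y} (\<phi> n \<omega> x) \<partial>M) \<partial>count_space UNIV)"
    if F: "\<And>x. (\<lambda>\<omega>. F \<omega> x) \<in> borel_measurable (past_algebra 0)" for F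
  proof -
    have [measurable]: "(\<lambda>\<omega>. F \<omega> x) \<in> borel_measurable M" for x
      using measurable_from_subalg[OF subalgebra_past F] .
    have [measurable]: "h \<in> borel_measurable M"
      using measurable_from_subalg[OF subalgebra_pullback_filtration h] .
    have spf: "space (future_algebra 0) = space M" using subalgebra_future by (auto simp: subalgebra_def)
    have "(\<integral>\<^sup>+\<omega>. h \<omega> * (\<integral>\<^sup>+x. F (\<theta> (- int n) \<omega>) x * indicator {y} (\<phi> n (\<theta> (- int n) \<omega>) x) \<partial>count_space UNIV) \<partial>M)
       = (\<integral>\<^sup>+\<omega>. \<integral>\<^sup>+x. h \<omega> * (F (\<theta> (- int n) \<omega>) x * indicator {y} (\<phi> n (\<theta> (- int n) \<omega>) x)) \<partial>count_space UNIV \<partial>M)"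
      by (simp add: nn_integral_cmult)
    also have "\<dots> = (\<integral>\<^sup>+x. \<integral>\<^sup>+\<omega>. h \<omega> * (F (\<theta> (- int n) \<omega>) x * indicator {y} (\<phi> n (\<theta> (- int n) \<omega>) x)) \<partial>M \<partial>count_space UNIV)"
      by (rule nn_integral_count_space_nn_integral) auto
    also have "\<dots> = (\<integral>\<^sup>+x. (\<integral>\<^sup>+\<omega>. F \<omega> x \<partial>M) * (\<integral>\<^sup>+\<omega>. h (\<theta> (int n) \<omega>) * indicator {y} (\<phi> n \<omega> x) \<partial>M) \<partial>count_space UNIV)"
    proof (intro nn_integral_cong)
      fix x
      have "(\<integral>\<^sup>+\<omega>. h \<omega> * (F (\<theta> (- int n) \<omega>) x * indicator {y} (\<phi> n (\<theta> (- int n) \<omega>) x)) \<partial>M)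
         = (\<integral>\<^sup>+\<omega>. h (\<theta> (int n) \<omega>) * (F (\<theta> (- int n) (\<theta> (int n) \<omega>)) x * indicator {y} (\<phi> n (\<theta> (- int n) (\<theta> (int n) \<omega>)) x)) \<partial>M)"
        by (rule nn_integral_theta[symmetric]) measurable
      also have "\<dots> = (\<integral>\<^sup>+\<omega>. F \<omega> x * (h (\<theta> (int n) \<omega>) * indicator {y} (\<phi> n \<omega> x)) \<partial>M)"
        by (intro nn_integral_cong) (simp add: mult_ac)
      also have "\<dots> = (\<integral>\<^sup>+\<omega>. F \<omega> x \<partial>M) * (\<integral>\<^sup>+\<omega>. h (\<theta> (int n) \<omega>) * indicator {y} (\<phi> n \<omega> x) \<partial>M)"
      proof (rule indep_set_nn_integral_mult[OF subalgebra_past subalgebra_future markov F])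
        have "{\<omega>\<in>space M. \<phi> n \<omega> x = y} = {\<omega>\<in>space M. \<phi> n (\<theta> 0 \<omega>) x = y}"
          using theta_zero by auto
        then have "(\<lambda>\<omega>. indicator {y} (\<phi> n \<omega> x) :: ennreal) \<in> borel_measurable (future_algebra 0)"
          using future_algebra_generator[of 0 0 n x y] by (intro borel_measurable_indicator_singleton[where K=M]) (simp_all add: spf)
        then show "(\<lambda>\<omega>. h (\<theta> (int n) \<omega>) * indicator {y} (\<phi> n \<omega> x)) \<in> borel_measurable (future_algebra 0)"
          using measurable_compose[OF measurable_theta_future h] by measurable
      qed
      finally show "(\<integral>\<^sup>+\<omega>. h \<omega> * (F (\<theta> (- int n) \<omega>) x * indicator {y} (\<phi> n (\<theta> (- int n) \<omega>) x)) \<partial>M)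
        = (\<integral>\<^sup>+\<omega>. F \<omega> x \<partial>M) * (\<integral>\<^sup>+\<omega>. h (\<theta> (int n) \<omega>) * indicator {y} (\<phi> n \<omega> x) \<partial>M)" .
    qed
    finally show ?thesis .
  qed
  show ?thesis
    unfolding gen[OF F] pullback_mass_def f
    by (subst gen) (auto simp: emeasure_space_1)
qed

text \<open>Chapman-Kolmogorov. The first step is regarded as a random point mass \<open>F\<close>
  belonging to the past, and independence is applied with \<open>h = 1\<close>.\<close>

lemma step_prob_Suc: "step_prob (Suc n) x y
    = (\<integral>\<^sup>+z. step_prob 1 x z * step_prob n z y \<partial>count_space UNIV)"
proof -
  define F where "F \<omega> z = (indicator {z} (\<phi> 1 (\<theta> (- 1) \<omega>) x) :: ennreal)" for \<omega> z
  have sp: "space (past_algebra 0) = space M" using subalgebra_past by (auto simp: subalgebra_def)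
  have F: "(\<lambda>\<omega>. F \<omega> z) \<in> borel_measurable (past_algebra 0)" for z
    unfolding F_def by (intro borel_measurable_indicator_singleton[where K=M] past_algebra_generator[of "- 1"]) (auto simp: sp)
  have f: "(\<integral>\<^sup>+\<omega>. F \<omega> z \<partial>M) = step_prob 1 x z" for z
    unfolding F_def using nn_integral_indicator_phi_theta[of z 1 "- 1" x] by simp
  have "step_prob (Suc n) x y = (\<integral>\<^sup>+\<omega>. indicator {y} (\<phi> (Suc n) (\<theta> (- int (Suc n)) \<omega>) x) \<partial>M)"
    by (rule nn_integral_indicator_phi_theta[symmetric])
  also have "\<dots> = (\<integral>\<^sup>+\<omega>. 1 * (\<integral>\<^sup>+z. F (\<theta> (- int n) \<omega>) z * indicator {y} (\<phi> n (\<theta> (- int n) \<omega>) z) \<partial>count_space UNIV) \<partial>M)"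
    unfolding F_def by (intro nn_integral_cong)
      (simp add: nn_integral_count_space_singleton phi_pullback_Suc del: of_nat_Suc)
  also have "\<dots> = (\<integral>\<^sup>+\<omega>. 1 * pullback_mass (step_prob 1 x) n y \<omega> \<partial>M)"
    by (rule nn_integral_pullback_independent) (auto simp: F f)
  also have "\<dots> = (\<integral>\<^sup>+z. step_prob 1 x z * step_prob n z y \<partial>count_space UNIV)"
    by (simp add: nn_integral_pullback_mass)
  finally show ?thesis .
qed

lemma stationary_density_step:
  assumes "stationary_density f"
  shows "(\<integral>\<^sup>+x. f x * step_prob n x y \<partial>count_space UNIV) = f y"
proof (induction n)
  case 0
  have "step_prob 0 x y = indicator {y} x" for x
    unfolding step_prob_def
    by (subst nn_integral_cong[where v="\<lambda>_. indicator {y} x"]) (auto simp: phi_zero emeasure_space_1)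
  then show ?case by simp
next
  case (Suc n)
  have "(\<integral>\<^sup>+x. f x * step_prob (Suc n) x y \<partial>count_space UNIV)
     = (\<integral>\<^sup>+x. \<integral>\<^sup>+z. f x * (step_prob 1 x z * step_prob n z y) \<partial>count_space UNIV \<partial>count_space UNIV)"
    unfolding step_prob_Suc by (simp add: nn_integral_cmult)
  also have "\<dots> = (\<integral>\<^sup>+z. \<integral>\<^sup>+x. f x * step_prob 1 x z * step_prob n z y \<partial>count_space UNIV \<partial>count_space UNIV)"
    by (subst nn_integral_count_space_swap) (simp add: mult_ac)
  also have "\<dots> = (\<integral>\<^sup>+z. f z * step_prob n z y \<partial>count_space UNIV)"
    using assms by (simp add: nn_integral_multc stationary_density_def)
  finally show ?case using Suc by simp
qed

lemma stationary_density_pos: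
  assumes "irreducible_chain" "stationary_density f" "0 < f x"
  shows "0 < f y"
proof -
  obtain n where "0 < \<P>(\<omega> in M. \<phi> n \<omega> x = y)"
    using assms(1) unfolding irreducible_chain_def by blast
  then have "0 < f x * step_prob n x y" using assms(3) by (simp add: step_prob_eq ennreal_zero_less_mult_iff)
  also have "\<dots> \<le> (\<integral>\<^sup>+x. f x * step_prob n x y \<partial>count_space UNIV)"
    by (rule nn_integral_count_space_ge)
  finally show ?thesis using stationary_density_step[OF assms(2)] by simp
qed

text \<open>The positive part of a difference of stationary densities is again stationary, so by
  irreducibility it vanishes everywhere or nowhere.\<close>

lemma stationary_density_unique:
  assumes irr: "irreducible_chain" and a: "stationary_density a" and b: "stationary_density b"
    and eq: "(\<integral>\<^sup>+x. a x \<partial>count_space UNIV) = (\<integral>\<^sup>+x. b x \<partial>count_space UNIV)"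
    and fin: "(\<integral>\<^sup>+x. a x \<partial>count_space UNIV) < \<infinity>"
  shows "a x = b x"
proof -
  \<comment> \<open>Subtraction in \<open>ennreal\<close> truncates at 0, so \<open>c\<close> is the
    positive part of the difference.\<close>
  define c where "c x = a x - b x" for x
  have bfin: "b x < \<infinity>" for x
    using nn_integral_count_space_ge[of b x] eq fin by (metis order_le_less_trans)
  have cfin: "(\<integral>\<^sup>+x. c x \<partial>count_space UNIV) < \<infinity>"
  proof -
    have "(\<integral>\<^sup>+x. c x \<partial>count_space UNIV) \<le> (\<integral>\<^sup>+x. a x \<partial>count_space UNIV)"
      by (intro nn_integral_mono) (simp add: c_def)
    then show ?thesis using fin by (rule order_le_less_trans)
  qed
  have le: "c y \<le> (\<integral>\<^sup>+x. c x * step_prob 1 x y \<partial>count_space UNIV)" for y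
  proof -
    have le1: "a x \<le> c x + b x" for x
      by (auto simp: c_def diff_add_self_ennreal)
    have "a y = (\<integral>\<^sup>+x. a x * step_prob 1 x y \<partial>count_space UNIV)"
      using a by (simp add: stationary_density_def)
    also have "\<dots> \<le> (\<integral>\<^sup>+x. c x * step_prob 1 x y + b x * step_prob 1 x y \<partial>count_space UNIV)"
      by (intro nn_integral_mono) (auto simp: distrib_right[symmetric] intro!: mult_right_mono le1)
    also have "\<dots> = (\<integral>\<^sup>+x. c x * step_prob 1 x y \<partial>count_space UNIV) + (\<integral>\<^sup>+x. b x * step_prob 1 x y \<partial>count_space UNIV)"
      by (rule nn_integral_add) auto
    also have "(\<integral>\<^sup>+x. b x * step_prob 1 x y \<partial>count_space UNIV) = b y"
      using b by (simp add: stationary_density_def)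
    finally show ?thesis unfolding c_def using bfin[of y]
      by (subst ennreal_minus_le_iff) (auto simp: add.commute)
  qed
  \<comment> \<open>Transition probabilities sum to 1, so both sides of \<open>le\<close> have the
    same finite total. The inequality therefore holds with equality at every state.\<close>
  have "(\<integral>\<^sup>+y. \<integral>\<^sup>+x. c x * step_prob 1 x y \<partial>count_space UNIV \<partial>count_space UNIV)
      = (\<integral>\<^sup>+x. c x \<partial>count_space UNIV)"
    by (subst nn_integral_count_space_swap) (simp add: nn_integral_cmult sum_step_prob)
  then have cc: "c y = (\<integral>\<^sup>+x. c x * step_prob 1 x y \<partial>count_space UNIV)" for y
    by (intro nn_integral_count_space_eqD[OF le _ cfin]) simp
  have c: "stationary_density c"
    unfolding stationary_density_def by (intro allI cc[symmetric])
  have le_a: "a y \<le> b y" for y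
  proof (rule ccontr)
    assume "\<not> a y \<le> b y"
    then have "0 < c y" unfolding c_def by (simp add: diff_gr0_ennreal)
    then have "0 < c z" for z using stationary_density_pos[OF irr c] by blast
    then have pos: "0 < a z - b z" for z unfolding c_def .
    have less: "b z < a z" for z
    proof (rule ccontr)
      assume "\<not> b z < a z"
      then have "a z \<le> b z" by simp
      then have "a z - b z = 0" using bfin[of z] by (intro diff_eq_0_ennreal) (auto intro: order_le_less_trans)
      then show False using pos[of z] by simp
    qed
    have "b y = a y" for y
      by (rule nn_integral_count_space_eqD[OF less_imp_le[OF less]]) (use fin eq in auto)
    then show False using less by simp
  qed
  show ?thesis by (rule nn_integral_count_space_eqD[OF le_a]) (use eq fin in auto)
qed

end

section \<open>Sums over a countable set and limits of expectations\<close>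

lemma nn_integral_count_space_has_sum:
  fixes f :: "'a \<Rightarrow> real"
  assumes "(f has_sum s) UNIV" "\<And>x. 0 \<le> f x"
  shows "(\<integral>\<^sup>+x. ennreal (f x) \<partial>count_space UNIV) = ennreal s"
proof -
  have "f summable_on UNIV" using assms(1) by (rule has_sum_imp_summable)
  then have "(\<lambda>x. norm (f x)) summable_on UNIV" using assms(2) by simp
  then have "Infinite_Set_Sum.abs_summable_on f UNIV" unfolding abs_summable_equivalent .
  then show ?thesis
    using nn_integral_conv_infsetsum[of f UNIV] infsetsum_infsum[of f UNIV] infsumI[OF assms(1)] assms(2)
    by simp
qed

lemma finite_superlevel_count_space:
  fixes f :: "'a \<Rightarrow> ennreal"
  assumes "(\<integral>\<^sup>+x. f x \<partial>count_space UNIV) < \<infinity>" "0 < e"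
  shows "finite {x. e \<le> f x}"
proof (rule ccontr)
  assume inf: "infinite {x. e \<le> f x}"
  have "\<infinity> = (\<integral>\<^sup>+x. e * indicator {x. e \<le> f x} x \<partial>count_space UNIV)"
    using assms(2) inf by (subst nn_integral_cmult_indicator) (auto simp: emeasure_count_space_infinite ennreal_mult_top)
  also have "\<dots> \<le> (\<integral>\<^sup>+x. f x \<partial>count_space UNIV)"
    by (intro nn_integral_mono) (auto simp: indicator_def)
  finally show False using assms(1) by simp
qed

text \<open>Some value is positive, and only finitely many points reach at least that value; a
  maximum over these points is a global one.\<close>

lemma count_space_has_maximum:
  fixes f :: "'a \<Rightarrow> ennreal"
  assumes "(\<integral>\<^sup>+x. f x \<partial>count_space UNIV) < \<infinity>" "0 < (\<integral>\<^sup>+x. f x \<partial>count_space UNIV)"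
  obtains y where "0 < f y" "\<And>z. f z \<le> f y"
proof -
  obtain x where x: "0 < f x"
  proof (rule ccontr)
    assume "\<not> thesis"
    then have "f x = 0" for x using that[of x] by (simp add: zero_less_iff_neq_zero) blast
    then show False using assms(2) by simp
  qed
  define S where "S = {z. f x \<le> f z}"
  have S: "finite S" "x \<in> S" using finite_superlevel_count_space[OF assms(1) x] by (auto simp: S_def)
  have "Max (f ` S) \<in> f ` S" using S by (intro Max_in) auto
  then obtain y where y: "y \<in> S" "f y = Max (f ` S)" by auto
  show ?thesis
  proof (rule that)
    show "0 < f y" using x y(1) by (auto simp: S_def)
    show "f z \<le> f y" for z
    proof (cases "z \<in> S")
      case True then show ?thesis using S y(2) by simp
    next
      case False then show ?thesis using y(1) by (auto simp: S_def)
    qed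
  qed
qed

lemma (in prob_space) nn_integral_bounded_convergence:
  fixes u :: "nat \<Rightarrow> 'a \<Rightarrow> ennreal"
  assumes "\<And>n. u n \<in> borel_measurable M" "v \<in> borel_measurable M"
    and "\<And>n \<omega>. \<omega> \<in> space M \<Longrightarrow> u n \<omega> \<le> 1" and "AE \<omega> in M. (\<lambda>n. u n \<omega>) \<longlonglongrightarrow> v \<omega>"
  shows "(\<lambda>n. \<integral>\<^sup>+\<omega>. u n \<omega> \<partial>M) \<longlonglongrightarrow> (\<integral>\<^sup>+\<omega>. v \<omega> \<partial>M)"
  by (rule nn_integral_dominated_convergence[where w="\<lambda>_. 1"]) (use assms in \<open>auto simp: emeasure_space_1\<close>)

lemma (in prob_space) AE_eq_of_nn_integral_le:
  fixes f g :: "'a \<Rightarrow> ennreal"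
  assumes [measurable]: "f \<in> borel_measurable M" "g \<in> borel_measurable M"
    and le: "AE \<omega> in M. f \<omega> \<le> g \<omega>" and ge: "(\<integral>\<^sup>+\<omega>. g \<omega> \<partial>M) \<le> (\<integral>\<^sup>+\<omega>. f \<omega> \<partial>M)"
    and fin: "(\<integral>\<^sup>+\<omega>. f \<omega> \<partial>M) < \<infinity>"
  shows "AE \<omega> in M. f \<omega> = g \<omega>"
proof -
  have "(\<integral>\<^sup>+\<omega>. g \<omega> - f \<omega> \<partial>M) = (\<integral>\<^sup>+\<omega>. g \<omega> \<partial>M) - (\<integral>\<^sup>+\<omega>. f \<omega> \<partial>M)"
    using fin le by (intro nn_integral_diff) auto
  also have "\<dots> = 0" using ge fin by (intro diff_eq_0_ennreal) auto
  finally have "AE \<omega> in M. g \<omega> - f \<omega> = 0" by (simp add: nn_integral_0_iff_AE)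
  with le show ?thesis by eventually_elim (auto dest: ennreal_minus_eq_0)
qed

section \<open>The limit mass and its largest atoms\<close>

locale stationary_markov_rds = markov_rds M \<theta> \<phi>
  for M :: "'w measure"
  and \<theta> :: "int \<Rightarrow> 'w \<Rightarrow> 'w"
  and \<phi> :: "nat \<Rightarrow> 'w \<Rightarrow> 'x :: countable \<Rightarrow> 'x" +
  fixes \<pi> :: "'x pmf"
  assumes irreducible: irreducible_chain
    and stationary: "stationary_distribution \<pi>"
begin

lemma pmf_stationary_density: "stationary_density (pmf \<pi>)"
  unfolding stationary_density_def
proof
  fix y
  have "(\<integral>\<^sup>+x. ennreal (pmf \<pi> x * transition_prob x y) \<partial>count_space UNIV) = ennreal (pmf \<pi> y)"
    using stationary unfolding stationary_distribution_def
    by (intro nn_integral_count_space_has_sum) (auto simp: transition_prob_def)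
  then show "(\<integral>\<^sup>+x. ennreal (pmf \<pi> x) * step_prob 1 x y \<partial>count_space UNIV) = ennreal (pmf \<pi> y)"
    by (simp add: step_prob_eq transition_prob_def ennreal_mult')
qed

lemma sum_pmf: "(\<integral>\<^sup>+x. ennreal (pmf \<pi> x) \<partial>count_space UNIV) = 1"
  by (simp add: nn_integral_pmf measure_pmf.emeasure_space_1[simplified])

lemma pmf_positive: "0 < pmf \<pi> x"
proof -
  obtain z where "z \<in> set_pmf \<pi>" using set_pmf_not_empty by fast
  then have "0 < ennreal (pmf \<pi> z)" by (simp add: pmf_positive_iff)
  from stationary_density_pos[OF irreducible pmf_stationary_density this, of x] show ?thesis by simp
qed

abbreviation mass :: "nat \<Rightarrow> 'x \<Rightarrow> 'w \<Rightarrow> ennreal" where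
  "mass \<equiv> pullback_mass (\<lambda>x. ennreal (pmf \<pi> x))"

lemma nn_integral_mass: "(\<integral>\<^sup>+\<omega>. mass n y \<omega> \<partial>M) = pmf \<pi> y"
  by (simp add: nn_integral_pullback_mass stationary_density_step[OF pmf_stationary_density])

lemma sum_mass: "(\<integral>\<^sup>+y. mass n y \<omega> \<partial>count_space UNIV) = 1"
  by (simp add: sum_pullback_mass sum_pmf)

lemma mass_le_1: "mass n y \<omega> \<le> 1"
  using nn_integral_count_space_ge[of "\<lambda>y. mass n y \<omega>" y] by (simp add: sum_mass)

text \<open>The mass arriving at time \<open>- n\<close> after the additional step is independent of
  \<open>h\<close> and of the last \<open>n\<close> steps. It may be replaced by its mean, which is
  again \<pi> by stationarity.\<close>

lemma mass_martingale:
  assumes h: "h \<in> borel_measurable (pullback_filtration n)"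
  shows "(\<integral>\<^sup>+\<omega>. h \<omega> * mass (Suc n) y \<omega> \<partial>M) = (\<integral>\<^sup>+\<omega>. h \<omega> * mass n y \<omega> \<partial>M)"
proof -
  have "(\<integral>\<^sup>+\<omega>. h \<omega> * mass (Suc n) y \<omega> \<partial>M) = (\<integral>\<^sup>+\<omega>. h \<omega> *
      (\<integral>\<^sup>+z. mass 1 z (\<theta> (- int n) \<omega>) * indicator {y} (\<phi> n (\<theta> (- int n) \<omega>) z) \<partial>count_space UNIV) \<partial>M)"
    by (intro nn_integral_cong) (simp add: pullback_mass_Suc)
  also have "\<dots> = (\<integral>\<^sup>+\<omega>. h \<omega> * mass n y \<omega> \<partial>M)"
    by (rule nn_integral_pullback_independent[OF _ h]) (auto simp: pullback_mass_measurable_past nn_integral_mass)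
  finally show ?thesis .
qed

text \<open>The upper limit exists for every \<omega>, so no version has to be chosen on the
  exceptional null set and measurability with respect to the past is immediate.\<close>

definition limit_mass :: "'x \<Rightarrow> 'w \<Rightarrow> ennreal" where
  "limit_mass y \<omega> = limsup (\<lambda>n. mass n y \<omega>)"

lemma limit_mass_measurable_past: "limit_mass y \<in> borel_measurable (past_algebra 0)"
  unfolding limit_mass_def[abs_def] by (intro borel_measurable_limsup pullback_mass_measurable_past)

lemma limit_mass_measurable [measurable]: "limit_mass y \<in> borel_measurable M"
  using measurable_from_subalg[OF subalgebra_past limit_mass_measurable_past] .

lemma limit_mass_le_1: "limit_mass y \<omega> \<le> 1"
  unfolding limit_mass_def by (intro Limsup_bounded always_eventually allI mass_le_1)

lemma mass_tendsto: "AE \<omega> in M. \<forall>y. (\<lambda>n. mass n y \<omega>) \<longlonglongrightarrow> limit_mass y \<omega>"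
proof -
  have fin: "mass n y \<omega> < top" for n y \<omega>
    using mass_le_1[of n y \<omega>] by (rule order_le_less_trans) simp
  have "AE \<omega> in M. convergent (\<lambda>n. enn2real (mass n y \<omega>))" for y
  proof (rule bounded_martingale_AE_convergent[where F=pullback_filtration and B=1])
    show "\<bar>enn2real (mass n y \<omega>)\<bar> \<le> 1" for n \<omega>
      using enn2real_mono[OF mass_le_1[of n y \<omega>]] by simp
    show "(\<lambda>\<omega>. enn2real (mass n y \<omega>)) \<in> borel_measurable (pullback_filtration n)" for n
      using pullback_mass_measurable_filtration by measurable
    fix n G assume G: "G \<in> sets (pullback_filtration n)"
    then have [measurable]: "G \<in> sets M"
      using subalgebra_pullback_filtration by (auto simp: subalgebra_def)
    have *: "(\<integral>\<omega>. indicator G \<omega> * enn2real (mass k y \<omega>) \<partial>M) = enn2real (\<integral>\<^sup>+\<omega>. indicator G \<omega> * mass k y \<omega> \<partial>M)" for k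
      by (subst integral_eq_nn_integral)
        (auto intro!: arg_cong[where f=enn2real] nn_integral_cong simp: fin ennreal_mult' ennreal_indicator)
    show "(\<integral>\<omega>. indicator G \<omega> * enn2real (mass (Suc n) y \<omega>) \<partial>M) = (\<integral>\<omega>. indicator G \<omega> * enn2real (mass n y \<omega>) \<partial>M)"
      unfolding * using G by (subst mass_martingale) auto
  qed (use subalgebra_pullback_filtration pullback_filtration_mono in auto)
  then have "AE \<omega> in M. \<forall>y. convergent (\<lambda>n. enn2real (mass n y \<omega>))"
    by (simp add: AE_all_countable)
  then show ?thesis
  proof eventually_elim
    fix \<omega> assume *: "\<forall>y. convergent (\<lambda>n. enn2real (mass n y \<omega>))"
    show "\<forall>y. (\<lambda>n. mass n y \<omega>) \<longlonglongrightarrow> limit_mass y \<omega>"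
    proof
      fix y
      obtain L where "(\<lambda>n. enn2real (mass n y \<omega>)) \<longlonglongrightarrow> L" using * by (auto simp: convergent_def)
      then have "(\<lambda>n. ennreal (enn2real (mass n y \<omega>))) \<longlonglongrightarrow> ennreal L" by (rule tendsto_ennrealI)
      then have "(\<lambda>n. mass n y \<omega>) \<longlonglongrightarrow> ennreal L" by (simp add: fin)
      moreover from lim_imp_Limsup[OF _ this] have "limit_mass y \<omega> = ennreal L"
        unfolding limit_mass_def by simp
      ultimately show "(\<lambda>n. mass n y \<omega>) \<longlonglongrightarrow> limit_mass y \<omega>" by simp
    qed
  qed
qed

lemma nn_integral_limit_mass: "(\<integral>\<^sup>+\<omega>. limit_mass y \<omega> \<partial>M) = pmf \<pi> y"
proof -
  have "(\<lambda>n. \<integral>\<^sup>+\<omega>. mass n y \<omega> \<partial>M) \<longlonglongrightarrow> (\<integral>\<^sup>+\<omega>. limit_mass y \<omega> \<partial>M)"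
    by (rule nn_integral_bounded_convergence) (use mass_tendsto in \<open>auto simp: mass_le_1\<close>)
  then show ?thesis by (simp add: nn_integral_mass LIMSEQ_const_iff)
qed

text \<open>No mass escapes to infinity: Fatou bounds the sum by 1, and its expectation is exactly 1
  because each \<open>limit_mass y\<close> has mean \<open>pmf \<pi> y\<close>.\<close>

lemma sum_limit_mass: "AE \<omega> in M. (\<integral>\<^sup>+y. limit_mass y \<omega> \<partial>count_space UNIV) = 1"
proof (rule AE_eq_of_nn_integral_le)
  show "(\<lambda>\<omega>. \<integral>\<^sup>+y. limit_mass y \<omega> \<partial>count_space UNIV) \<in> borel_measurable M"
    by (rule borel_measurable_nn_integral_count_space) measurable
  have "(\<integral>\<^sup>+\<omega>. \<integral>\<^sup>+y. limit_mass y \<omega> \<partial>count_space UNIV \<partial>M) = (\<integral>\<^sup>+y. \<integral>\<^sup>+\<omega>. limit_mass y \<omega> \<partial>M \<partial>count_space UNIV)"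
    by (rule nn_integral_count_space_nn_integral) auto
  also have "\<dots> = 1" by (simp add: nn_integral_limit_mass sum_pmf)
  finally have 1: "(\<integral>\<^sup>+\<omega>. \<integral>\<^sup>+y. limit_mass y \<omega> \<partial>count_space UNIV \<partial>M) = 1" .
  show "(\<integral>\<^sup>+\<omega>. 1 \<partial>M) \<le> (\<integral>\<^sup>+\<omega>. \<integral>\<^sup>+y. limit_mass y \<omega> \<partial>count_space UNIV \<partial>M)"
    "(\<integral>\<^sup>+\<omega>. \<integral>\<^sup>+y. limit_mass y \<omega> \<partial>count_space UNIV \<partial>M) < \<infinity>"
    by (auto simp: 1 emeasure_space_1)
  show "AE \<omega> in M. (\<integral>\<^sup>+y. limit_mass y \<omega> \<partial>count_space UNIV) \<le> 1"
    using mass_tendsto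
  proof eventually_elim
    fix \<omega> assume *: "\<forall>y. (\<lambda>n. mass n y \<omega>) \<longlonglongrightarrow> limit_mass y \<omega>"
    then have "limit_mass y \<omega> = liminf (\<lambda>n. mass n y \<omega>)" for y
      by (metis lim_imp_Liminf sequentially_bot)
    then have "(\<integral>\<^sup>+y. limit_mass y \<omega> \<partial>count_space UNIV) = (\<integral>\<^sup>+y. liminf (\<lambda>n. mass n y \<omega>) \<partial>count_space UNIV)"
      by simp
    also have "\<dots> \<le> liminf (\<lambda>n. \<integral>\<^sup>+y. mass n y \<omega> \<partial>count_space UNIV)"
      by (rule nn_integral_liminf) auto
    finally show "(\<integral>\<^sup>+y. limit_mass y \<omega> \<partial>count_space UNIV) \<le> 1" by (simp add: sum_mass Liminf_const)
  qed
qed auto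

text \<open>Fatou over the states \<open>z\<close> gives only an inequality. It is enough to make
  each atom at least as heavy after a step as before.\<close>

lemma limit_mass_theta: "AE \<omega> in M. \<forall>y. (\<integral>\<^sup>+z. limit_mass z \<omega> * indicator {y} (\<phi> 1 \<omega> z) \<partial>count_space UNIV)
    \<le> limit_mass y (\<theta> 1 \<omega>)"
  using mass_tendsto AE_theta[OF mass_tendsto, of 1] AE_space
proof eventually_elim
  fix \<omega> assume \<omega>: "\<omega> \<in> space M" and *: "\<forall>y. (\<lambda>n. mass n y \<omega>) \<longlonglongrightarrow> limit_mass y \<omega>"
    and **: "\<forall>y. (\<lambda>n. mass n y (\<theta> 1 \<omega>)) \<longlonglongrightarrow> limit_mass y (\<theta> 1 \<omega>)"
  show "\<forall>y. (\<integral>\<^sup>+z. limit_mass z \<omega> * indicator {y} (\<phi> 1 \<omega> z) \<partial>count_space UNIV) \<le> limit_mass y (\<theta> 1 \<omega>)"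
  proof
    fix y
    have "(\<lambda>n. mass n z \<omega> * indicator {y} (\<phi> 1 \<omega> z)) \<longlonglongrightarrow> limit_mass z \<omega> * indicator {y} (\<phi> 1 \<omega> z)" for z
      using * by (auto simp: indicator_def)
    then have l: "limit_mass z \<omega> * indicator {y} (\<phi> 1 \<omega> z) = liminf (\<lambda>n. mass n z \<omega> * indicator {y} (\<phi> 1 \<omega> z))" for z
      by (metis lim_imp_Liminf sequentially_bot)
    have "(\<integral>\<^sup>+z. limit_mass z \<omega> * indicator {y} (\<phi> 1 \<omega> z) \<partial>count_space UNIV)
       \<le> liminf (\<lambda>n. \<integral>\<^sup>+z. mass n z \<omega> * indicator {y} (\<phi> 1 \<omega> z) \<partial>count_space UNIV)"
      unfolding l by (rule nn_integral_liminf) auto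
    also have "\<dots> = liminf (\<lambda>n. mass (Suc n) y (\<theta> 1 \<omega>))"
      by (simp add: pullback_mass_theta[OF \<omega>])
    also have "\<dots> = limit_mass y (\<theta> 1 \<omega>)"
      by (intro lim_imp_Liminf LIMSEQ_Suc) (use ** in auto)
    finally show "(\<integral>\<^sup>+z. limit_mass z \<omega> * indicator {y} (\<phi> 1 \<omega> z) \<partial>count_space UNIV) \<le> limit_mass y (\<theta> 1 \<omega>)" .
  qed
qed

text \<open>The almost sure value of the largest atom, recovered as its mean; passing through
  \<open>ennreal\<close> of a real number makes it visibly finite. Its value turns out to be 1 /
  \<kappa>.\<close>

definition peak_mass :: ennreal where
  "peak_mass = ennreal (expectation (\<lambda>\<omega>. enn2real (SUP y. limit_mass y \<omega>)))"

lemma SUP_limit_mass: "AE \<omega> in M. (SUP y. limit_mass y \<omega>) = peak_mass"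
proof -
  have le1: "(SUP y. limit_mass y \<omega>) \<le> 1" for \<omega> by (intro SUP_least limit_mass_le_1)
  have fin: "(SUP y. limit_mass y \<omega>) < top" for \<omega> using le1 by (rule order_le_less_trans) simp
  have [measurable]: "(\<lambda>\<omega>. SUP y. limit_mass y \<omega>) \<in> borel_measurable M"
    by (intro borel_measurable_SUP) auto
  have "AE \<omega> in M. enn2real (SUP y. limit_mass y \<omega>) = expectation (\<lambda>\<omega>. enn2real (SUP y. limit_mass y \<omega>))"
  proof (rule ergodic_mono_AE_const)
    show "integrable M (\<lambda>\<omega>. enn2real (SUP y. limit_mass y \<omega>))"
      by (rule integrable_const_bound[where B=1]) (use enn2real_mono[OF le1] in auto)
    show "AE \<omega> in M. enn2real (SUP y. limit_mass y \<omega>) \<le> enn2real (SUP y. limit_mass y (\<theta> 1 \<omega>))"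
      using limit_mass_theta
    proof eventually_elim
      fix \<omega> assume *: "\<forall>y. (\<integral>\<^sup>+z. limit_mass z \<omega> * indicator {y} (\<phi> 1 \<omega> z) \<partial>count_space UNIV)
        \<le> limit_mass y (\<theta> 1 \<omega>)"
      have "limit_mass z \<omega> \<le> limit_mass (\<phi> 1 \<omega> z) (\<theta> 1 \<omega>)" for z
        using order_trans[OF nn_integral_count_space_ge[of "\<lambda>z'. limit_mass z' \<omega> * indicator {\<phi> 1 \<omega> z} (\<phi> 1 \<omega> z')" z] *[rule_format]]
        by simp
      then have "(SUP y. limit_mass y \<omega>) \<le> (SUP y. limit_mass y (\<theta> 1 \<omega>))"
        by (intro SUP_least) (metis SUP_upper2 UNIV_I)
      then show "enn2real (SUP y. limit_mass y \<omega>) \<le> enn2real (SUP y. limit_mass y (\<theta> 1 \<omega>))"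
        using fin by (rule enn2real_mono)
    qed
  qed
  then show ?thesis
  proof eventually_elim
    case (elim \<omega>)
    have "(SUP y. limit_mass y \<omega>) = ennreal (enn2real (SUP y. limit_mass y \<omega>))" using fin by simp
    then show ?case unfolding elim peak_mass_def .
  qed
qed

text \<open>Comparison is with the constant \<open>peak_mass\<close>, not with the supremum at
  \<omega>; membership of \<open>y\<close> thus depends on \<open>limit_mass y\<close>
  alone.\<close>

definition attractor :: "'w \<Rightarrow> 'x set" where
  "attractor \<omega> = {y. limit_mass y \<omega> = peak_mass}"

lemma limit_mass_le_peak: "AE \<omega> in M. \<forall>y. limit_mass y \<omega> \<le> peak_mass"
  using SUP_limit_mass by eventually_elim (metis SUP_upper UNIV_I)

lemma attractor_nonempty: "AE \<omega> in M. attractor \<omega> \<noteq> {} \<and> 0 < peak_mass"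
  using SUP_limit_mass sum_limit_mass
proof eventually_elim
  fix \<omega> assume s: "(SUP y. limit_mass y \<omega>) = peak_mass" and 1: "(\<integral>\<^sup>+y. limit_mass y \<omega> \<partial>count_space UNIV) = 1"
  obtain y where y: "0 < limit_mass y \<omega>" "\<And>z. limit_mass z \<omega> \<le> limit_mass y \<omega>"
    using count_space_has_maximum[of "\<lambda>y. limit_mass y \<omega>"] 1 by auto
  have "(SUP y. limit_mass y \<omega>) = limit_mass y \<omega>"
    using y(2) by (intro antisym SUP_least SUP_upper) auto
  then show "attractor \<omega> \<noteq> {} \<and> 0 < peak_mass" using s y(1) by (auto simp: attractor_def)
qed

lemma peak_mass_positive: "0 < peak_mass"
proof -
  have "AE \<omega> in M. 0 < peak_mass" using attractor_nonempty by eventually_elim simp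
  then show ?thesis by simp
qed

end

section \<open>Structure of the attractor\<close>

lemma sum_eq_nn_integral_count_space:
  fixes f :: "'a \<Rightarrow> ennreal"
  assumes "finite S"
  shows "(\<Sum>x\<in>S. f x) = (\<integral>\<^sup>+x. f x * indicator S x \<partial>count_space UNIV)"
  using assms by (subst nn_integral_count_space'[where A=S]) (auto simp: indicator_def)

text \<open>Injectivity keeps unit masses separate, so transporting the counting mass of
  \<open>S\<close> gives the counting mass of its image.\<close>

lemma nn_integral_indicator_image:
  fixes f :: "'a \<Rightarrow> 'b"
  assumes "inj_on f S"
  shows "(\<integral>\<^sup>+x. indicator S x * indicator {y} (f x) \<partial>count_space UNIV) = (indicator (f ` S) y :: ennreal)"
proof (cases "y \<in> f ` S")
  case True
  then obtain x where x: "x \<in> S" "y = f x" by blast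
  have "(\<integral>\<^sup>+z. indicator S z * indicator {y} (f z) \<partial>count_space UNIV) = (\<integral>\<^sup>+z. indicator {x} z \<partial>count_space UNIV)"
    using x inj_onD[OF assms] by (intro nn_integral_cong) (auto simp: indicator_def)
  then show ?thesis using True by simp
next
  case False
  have "(\<integral>\<^sup>+z. indicator S z * indicator {y} (f z) \<partial>count_space UNIV) = (\<integral>\<^sup>+z. 0 \<partial>count_space (UNIV :: 'a set))"
    by (intro nn_integral_cong) (use False in \<open>auto simp: indicator_def\<close>)
  then show ?thesis using False by simp
qed

text \<open>Gives measurability of the cardinality of a random set. For infinite \<open>S\<close>
  both conventions agree: \<open>card\<close> is 0, and so is \<open>enn2real\<close> of
  infinity.\<close>

lemma real_card_eq_nn_integral: "real (card S) = enn2real (\<integral>\<^sup>+x. indicator S x \<partial>count_space UNIV)"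
  by (cases "finite S") (simp_all add: emeasure_count_space_infinite)

lemma (in rds) AE_invariant_iterate:
  assumes "AE \<omega> in M. \<phi> 1 \<omega> ` B \<omega> = B (\<theta> 1 \<omega>)"
  shows "AE \<omega> in M. \<forall>n. \<phi> n \<omega> ` B \<omega> = B (\<theta> (int n) \<omega>)"
proof -
  have "AE \<omega> in M. \<forall>n. \<phi> 1 (\<theta> (int n) \<omega>) ` B (\<theta> (int n) \<omega>) = B (\<theta> 1 (\<theta> (int n) \<omega>))"
    by (subst AE_all_countable) (intro allI AE_theta assms)
  with AE_space show ?thesis
  proof eventually_elim
    fix \<omega> assume \<omega>: "\<omega> \<in> space M"
      and *: "\<forall>n. \<phi> 1 (\<theta> (int n) \<omega>) ` B (\<theta> (int n) \<omega>) = B (\<theta> 1 (\<theta> (int n) \<omega>))"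
    show "\<forall>n. \<phi> n \<omega> ` B \<omega> = B (\<theta> (int n) \<omega>)"
    proof
      fix n show "\<phi> n \<omega> ` B \<omega> = B (\<theta> (int n) \<omega>)"
      proof (induction n)
        case 0 then show ?case using phi_zero[OF \<omega>] theta_zero[OF \<omega>] by simp
      next
        case (Suc n)
        have "\<phi> (Suc n) \<omega> ` B \<omega> = \<phi> 1 (\<theta> (int n) \<omega>) ` (\<phi> n \<omega> ` B \<omega>)"
          using phi_cocycle[OF \<omega>, of 1 n] by (auto simp: image_image)
        also have "\<dots> = B (\<theta> (int (Suc n)) \<omega>)"
          unfolding Suc using * theta_add[OF \<omega>, of 1 "int n"] by simp
        finally show ?case .
      qed
    qed
  qed
qed

lemma (in rds) pullback_mass_scale: "pullback_mass (\<lambda>x. c * f x) n y \<omega> = c * pullback_mass f n y \<omega>"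
  unfolding pullback_mass_def by (simp add: mult.assoc nn_integral_cmult)

context stationary_markov_rds
begin

lemma attractor_indicator_past: "(\<lambda>\<omega>. indicator (attractor \<omega>) y :: ennreal) \<in> borel_measurable (past_algebra 0)"
  and attractor_set_measurable_past: "set_measurable_wrt (past_algebra 0) attractor"
proof -
  have sp: "space (past_algebra 0) = space M" using subalgebra_past by (auto simp: subalgebra_def)
  have E: "{\<omega>\<in>space M. limit_mass y \<omega> = peak_mass} \<in> sets (past_algebra 0)" for y
    using measurable_sets[OF limit_mass_measurable_past, of "{peak_mass}" y]
    by (simp add: sp vimage_def Int_def conj_commute)
  have "(\<lambda>\<omega>. indicator {\<omega>\<in>space M. limit_mass y \<omega> = peak_mass} \<omega> :: real) \<in> borel_measurable (past_algebra 0)" for y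
    using E by (intro borel_measurable_indicator)
  then have "(\<lambda>\<omega>. indicator (attractor \<omega>) y :: real) \<in> borel_measurable (past_algebra 0)" for y
    by (rule measurable_cong[THEN iffD1, rotated]) (auto simp: sp indicator_def attractor_def)
  then show "set_measurable_wrt (past_algebra 0) attractor" by (simp add: set_measurable_wrt_def)
  have "(\<lambda>\<omega>. indicator {peak_mass} (limit_mass y \<omega>) :: ennreal) \<in> borel_measurable (past_algebra 0)"
    by (rule borel_measurable_indicator_singleton[where K=M]) (use E sp in auto)
  moreover have "(\<lambda>\<omega>. indicator {peak_mass} (limit_mass y \<omega>) :: ennreal) = (\<lambda>\<omega>. indicator (attractor \<omega>) y)"
    by (auto simp: fun_eq_iff attractor_def indicator_def)
  ultimately show "(\<lambda>\<omega>. indicator (attractor \<omega>) y :: ennreal) \<in> borel_measurable (past_algebra 0)" by simp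
qed

lemma attractor_indicator_measurable [measurable]: "(\<lambda>\<omega>. indicator (attractor \<omega>) y :: ennreal) \<in> borel_measurable M"
  using measurable_from_subalg[OF subalgebra_past attractor_indicator_past] .

lemma attractor_pred [measurable]: "Measurable.pred M (\<lambda>\<omega>. y \<in> attractor \<omega>)"
  unfolding attractor_def by measurable

lemma attractor_finite: "AE \<omega> in M. finite (attractor \<omega>)"
  using sum_limit_mass
proof eventually_elim
  fix \<omega> assume "(\<integral>\<^sup>+y. limit_mass y \<omega> \<partial>count_space UNIV) = 1"
  then have "finite {y. peak_mass \<le> limit_mass y \<omega>}"
    by (intro finite_superlevel_count_space) (auto simp: peak_mass_positive)
  then show "finite (attractor \<omega>)" by (rule rev_finite_subset) (auto simp: attractor_def)
qed

text \<open>An atom of maximal mass is mapped to an atom of at least, hence of exactly, the same mass, and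
  two such atoms cannot merge.\<close>

lemma attractor_map:
  "AE \<omega> in M. inj_on (\<phi> 1 \<omega>) (attractor \<omega>) \<and> \<phi> 1 \<omega> ` attractor \<omega> \<subseteq> attractor (\<theta> 1 \<omega>)"
  using limit_mass_theta AE_theta[OF limit_mass_le_peak, of 1]
proof eventually_elim
  fix \<omega> assume *: "\<forall>y. (\<integral>\<^sup>+z. limit_mass z \<omega> * indicator {y} (\<phi> 1 \<omega> z) \<partial>count_space UNIV) \<le> limit_mass y (\<theta> 1 \<omega>)"
    and le: "\<forall>y. limit_mass y (\<theta> 1 \<omega>) \<le> peak_mass"
  have "attractor (\<theta> 1 \<omega>) \<supseteq> \<phi> 1 \<omega> ` attractor \<omega>"
  proof safe
    fix x assume x: "x \<in> attractor \<omega>"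
    have "limit_mass x \<omega> \<le> limit_mass (\<phi> 1 \<omega> x) (\<theta> 1 \<omega>)"
      using order_trans[OF nn_integral_count_space_ge[of "\<lambda>z. limit_mass z \<omega> * indicator {\<phi> 1 \<omega> x} (\<phi> 1 \<omega> z)" x] *[rule_format]]
      by simp
    with x le show "\<phi> 1 \<omega> x \<in> attractor (\<theta> 1 \<omega>)" by (auto simp: attractor_def intro: antisym)
  qed
  moreover have "inj_on (\<phi> 1 \<omega>) (attractor \<omega>)"
  proof (rule inj_onI, rule ccontr)
    fix x y assume x: "x \<in> attractor \<omega>" and y: "y \<in> attractor \<omega>"
      and eq: "\<phi> 1 \<omega> x = \<phi> 1 \<omega> y" and ne: "x \<noteq> y"
    have sum2: "(\<Sum>z\<in>{x, y}. h z) = h x + h y" for h :: "'x \<Rightarrow> ennreal" using ne by simp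
    have "peak_mass + peak_mass = (\<Sum>z\<in>{x, y}. limit_mass z \<omega> * indicator {\<phi> 1 \<omega> y} (\<phi> 1 \<omega> z))"
      unfolding sum2 using x y eq by (simp add: attractor_def)
    also have "\<dots> \<le> (\<integral>\<^sup>+z. limit_mass z \<omega> * indicator {\<phi> 1 \<omega> y} (\<phi> 1 \<omega> z) \<partial>count_space UNIV)"
      by (subst sum_eq_nn_integral_count_space) (auto intro!: nn_integral_mono simp: indicator_def)
    also have "\<dots> \<le> peak_mass" using * le by (meson order_trans)
    finally have "peak_mass + peak_mass \<le> peak_mass" .
    moreover obtain c where "peak_mass = ennreal c" "0 < c"
      using peak_mass_positive by (auto simp: peak_mass_def)
    ultimately show False by (simp flip: ennreal_plus)
  qed
  ultimately show "inj_on (\<phi> 1 \<omega>) (attractor \<omega>) \<and> \<phi> 1 \<omega> ` attractor \<omega> \<subseteq> attractor (\<theta> 1 \<omega>)" by blast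
qed

text \<open>The cardinality almost surely equals its mean, so the mean is an integer and the
  rounding is exact.\<close>

definition attractor_card :: nat where
  "attractor_card = nat \<lfloor>expectation (\<lambda>\<omega>. real (card (attractor \<omega>)))\<rfloor>"

lemma card_attractor: "AE \<omega> in M. card (attractor \<omega>) = attractor_card"
proof -
  have [measurable]: "(\<lambda>\<omega>. real (card (attractor \<omega>))) \<in> borel_measurable M"
    unfolding real_card_eq_nn_integral
    by (intro borel_measurable_enn2real borel_measurable_nn_integral_count_space) measurable
  obtain c where c: "peak_mass = ennreal c" "0 < c"
    using peak_mass_positive by (auto simp: peak_mass_def)
  have "AE \<omega> in M. real (card (attractor \<omega>)) = expectation (\<lambda>\<omega>. real (card (attractor \<omega>)))"
  proof (rule ergodic_mono_AE_const)
    show "integrable M (\<lambda>\<omega>. real (card (attractor \<omega>)))"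
    \<comment> \<open>All points of the attractor have the same mass \<open>c\<close> and the total
      mass is 1, so there are at most \<open>1 / c\<close> of them.\<close>
    proof (rule integrable_const_bound[where B="1 / c"])
      show "AE \<omega> in M. norm (real (card (attractor \<omega>))) \<le> 1 / c"
        using attractor_finite sum_limit_mass
      proof eventually_elim
        fix \<omega> assume fin: "finite (attractor \<omega>)" and 1: "(\<integral>\<^sup>+y. limit_mass y \<omega> \<partial>count_space UNIV) = 1"
        have "ennreal (real (card (attractor \<omega>)) * c) = (\<Sum>y\<in>attractor \<omega>. limit_mass y \<omega>)"
          using c by (simp add: attractor_def ennreal_mult' flip: ennreal_of_nat_eq_real_of_nat)
        also have "\<dots> \<le> (\<integral>\<^sup>+y. limit_mass y \<omega> \<partial>count_space UNIV)"
          by (subst sum_eq_nn_integral_count_space[OF fin]) (auto intro!: nn_integral_mono simp: indicator_def)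
        finally have "real (card (attractor \<omega>)) * c \<le> 1" using 1 by (simp add: ennreal_le_1)
        then show "norm (real (card (attractor \<omega>))) \<le> 1 / c" using c by (simp add: field_simps)
      qed
    qed measurable
    show "AE \<omega> in M. real (card (attractor \<omega>)) \<le> real (card (attractor (\<theta> 1 \<omega>)))"
      using attractor_map AE_theta[OF attractor_finite, of 1]
      by eventually_elim (auto intro: card_inj_on_le)
  qed
  then show ?thesis unfolding attractor_card_def by eventually_elim (metis floor_of_nat nat_int)
qed

lemma attractor_card_positive: "0 < attractor_card"
proof -
  have "AE \<omega> in M. 0 < attractor_card"
    using card_attractor attractor_finite attractor_nonempty by eventually_elim (auto simp: card_gt_0_iff)
  then show ?thesis by simp
qed

text \<open>The injective image has the same finite cardinality as the set containing it, so the
  inclusion is an equality.\<close>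

lemma attractor_invariant: "AE \<omega> in M. \<phi> 1 \<omega> ` attractor \<omega> = attractor (\<theta> 1 \<omega>)"
  using attractor_map card_attractor AE_theta[OF card_attractor, of 1] AE_theta[OF attractor_finite, of 1]
  by eventually_elim (metis card_image card_subset_eq)

lemma invariant_compact_attractor: "invariant_compact_random_set attractor"
proof -
  have "(\<lambda>\<omega>. indicator (attractor \<omega>) x :: real) \<in> borel_measurable M" for x
    using attractor_set_measurable_past measurable_from_subalg[OF subalgebra_past]
    unfolding set_measurable_wrt_def by blast
  then show ?thesis
    using attractor_finite attractor_invariant
    by (simp add: invariant_compact_random_set_def compact_random_set_def set_measurable_wrt_def)
qed

lemma attractor_iterate: "AE \<omega> in M. \<forall>n. \<phi> n \<omega> ` attractor \<omega> = attractor (\<theta> (int n) \<omega>)"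
  by (rule AE_invariant_iterate[OF attractor_invariant])

text \<open>This writes the attractor at time 0 as its earlier copy transported by the flow, in the
  shape to which independence applies. Injectivity of the \<open>n\<close>-step map follows from
  equality of the finite cardinalities.\<close>

lemma attractor_pullback_indicator:
  "AE \<omega> in M. (\<integral>\<^sup>+x. indicator (attractor (\<theta> (- int n) \<omega>)) x * indicator {y} (\<phi> n (\<theta> (- int n) \<omega>) x) \<partial>count_space UNIV)
     = (indicator (attractor \<omega>) y :: ennreal)"
proof -
  have "AE \<omega> in M. inj_on (\<phi> n \<omega>) (attractor \<omega>) \<and> \<phi> n \<omega> ` attractor \<omega> = attractor (\<theta> (int n) \<omega>)"
    using attractor_iterate attractor_finite card_attractor AE_theta[OF card_attractor, of "int n"]
    by eventually_elim (simp add: eq_card_imp_inj_on)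
  from AE_theta[OF this, of "- int n"] AE_space show ?thesis
    by eventually_elim (simp add: nn_integral_indicator_image)
qed

lemma nn_integral_attractor: "(\<integral>\<^sup>+\<omega>. indicator (attractor \<omega>) x \<partial>M) = of_nat attractor_card * ennreal (pmf \<pi> x)"
proof -
  define a where "a x = (\<integral>\<^sup>+\<omega>. indicator (attractor \<omega>) x \<partial>M)" for x
  have "stationary_density a"
    unfolding stationary_density_def
  proof
    fix y
    \<comment> \<open>One step of the chain applied to the mean \<open>a\<close> equals the mean of
      one step of the flow applied to the attractor itself, since the attractor at the start is
      determined by the past. Invariance then returns the attractor.\<close>
    have "(\<integral>\<^sup>+x. a x * step_prob 1 x y \<partial>count_space UNIV) = (\<integral>\<^sup>+\<omega>. 1 * pullback_mass a 1 y \<omega> \<partial>M)"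
      by (simp add: nn_integral_pullback_mass)
    also have "\<dots> = (\<integral>\<^sup>+\<omega>. 1 * (\<integral>\<^sup>+x. indicator (attractor (\<theta> (- int 1) \<omega>)) x * indicator {y} (\<phi> 1 (\<theta> (- int 1) \<omega>) x) \<partial>count_space UNIV) \<partial>M)"
      by (rule nn_integral_pullback_independent[symmetric]) (auto simp: a_def attractor_indicator_past)
    also have "\<dots> = a y"
      unfolding a_def using attractor_pullback_indicator[of 1 y] by (intro nn_integral_cong_AE) auto
    finally show "(\<integral>\<^sup>+x. a x * step_prob 1 x y \<partial>count_space UNIV) = a y" .
  qed
  moreover have "stationary_density (\<lambda>x. of_nat attractor_card * ennreal (pmf \<pi> x))"
    using pmf_stationary_density by (simp add: stationary_density_def mult.assoc nn_integral_cmult)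
  moreover have "(\<integral>\<^sup>+x. a x \<partial>count_space UNIV) = of_nat attractor_card"
  proof -
    have "(\<integral>\<^sup>+x. a x \<partial>count_space UNIV) = (\<integral>\<^sup>+\<omega>. \<integral>\<^sup>+x. indicator (attractor \<omega>) x \<partial>count_space UNIV \<partial>M)"
      unfolding a_def by (rule nn_integral_count_space_nn_integral[symmetric]) auto
    also have "\<dots> = (\<integral>\<^sup>+\<omega>. of_nat attractor_card \<partial>M)"
      by (intro nn_integral_cong_AE) (use card_attractor attractor_finite in \<open>eventually_elim, auto\<close>)
    finally show ?thesis by (simp add: emeasure_space_1)
  qed
  moreover have "(\<integral>\<^sup>+x. of_nat attractor_card * ennreal (pmf \<pi> x) \<partial>count_space UNIV) = of_nat attractor_card"
    by (simp add: nn_integral_cmult sum_pmf)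
  ultimately show ?thesis
    using stationary_density_unique[OF irreducible, of a "\<lambda>x. of_nat attractor_card * ennreal (pmf \<pi> x)" x]
    by (simp add: a_def of_nat_less_top)
qed

lemma prob_attractor: "\<P>(\<omega> in M. x \<in> attractor \<omega>) = real attractor_card * pmf \<pi> x"
proof -
  have "ennreal (\<P>(\<omega> in M. x \<in> attractor \<omega>)) = (\<integral>\<^sup>+\<omega>. indicator {\<omega>\<in>space M. x \<in> attractor \<omega>} \<omega> \<partial>M)"
    by (simp add: emeasure_eq_measure)
  also have "\<dots> = (\<integral>\<^sup>+\<omega>. indicator (attractor \<omega>) x \<partial>M)"
    by (intro nn_integral_cong) (auto simp: indicator_def)
  also have "\<dots> = ennreal (real attractor_card * pmf \<pi> x)"
    by (simp add: nn_integral_attractor ennreal_mult' ennreal_of_nat_eq_real_of_nat)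
  finally show ?thesis by simp
qed

text \<open>Both the limit mass and the normalised indicator of the attractor are limits of the same
  martingale. Comparing second moments avoids a further uniqueness argument for such limits.\<close>

lemma nn_integral_limit_mass_attractor:
  "(\<integral>\<^sup>+\<omega>. limit_mass y \<omega> * indicator (attractor \<omega>) y \<partial>M)
    = of_nat attractor_card * (\<integral>\<^sup>+\<omega>. limit_mass y \<omega> * limit_mass y \<omega> \<partial>M)"
proof -
  \<comment> \<open>Independence with weight \<open>h = mass n y\<close> replaces the attractor at
    time \<open>- n\<close> by its mean, which is \<kappa> times \<pi>. Transport to time 0 turns
    this into \<kappa> times a second copy of \<open>mass n y\<close>.\<close>
  have eq: "(\<integral>\<^sup>+\<omega>. mass n y \<omega> * indicator (attractor \<omega>) y \<partial>M)
      = of_nat attractor_card * (\<integral>\<^sup>+\<omega>. mass n y \<omega> * mass n y \<omega> \<partial>M)" for n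
  proof -
    have "(\<integral>\<^sup>+\<omega>. mass n y \<omega> * indicator (attractor \<omega>) y \<partial>M)
       = (\<integral>\<^sup>+\<omega>. mass n y \<omega> * (\<integral>\<^sup>+x. indicator (attractor (\<theta> (- int n) \<omega>)) x * indicator {y} (\<phi> n (\<theta> (- int n) \<omega>) x) \<partial>count_space UNIV) \<partial>M)"
      using attractor_pullback_indicator[of n y] by (intro nn_integral_cong_AE) auto
    also have "\<dots> = (\<integral>\<^sup>+\<omega>. mass n y \<omega> * pullback_mass (\<lambda>x. of_nat attractor_card * ennreal (pmf \<pi> x)) n y \<omega> \<partial>M)"
      by (rule nn_integral_pullback_independent)
        (auto simp: attractor_indicator_past pullback_mass_measurable_filtration nn_integral_attractor)
    also have "\<dots> = (\<integral>\<^sup>+\<omega>. of_nat attractor_card * (mass n y \<omega> * mass n y \<omega>) \<partial>M)"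
      by (simp only: pullback_mass_scale mult.left_commute)
    finally show ?thesis by (simp add: nn_integral_cmult)
  qed
  have le1: "a \<le> 1 \<Longrightarrow> b \<le> 1 \<Longrightarrow> a * b \<le> 1" for a b :: ennreal
    using mult_mono[of a 1 b 1] by simp
  have "(\<lambda>n. \<integral>\<^sup>+\<omega>. mass n y \<omega> * indicator (attractor \<omega>) y \<partial>M)
      \<longlonglongrightarrow> (\<integral>\<^sup>+\<omega>. limit_mass y \<omega> * indicator (attractor \<omega>) y \<partial>M)"
  proof (rule nn_integral_bounded_convergence)
    show "AE \<omega> in M. (\<lambda>n. mass n y \<omega> * indicator (attractor \<omega>) y) \<longlonglongrightarrow> limit_mass y \<omega> * indicator (attractor \<omega>) y"
      using mass_tendsto by eventually_elim (auto simp: indicator_def)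
  qed (auto intro!: le1 mass_le_1 simp: indicator_def)
  moreover have "(\<lambda>n. of_nat attractor_card * (\<integral>\<^sup>+\<omega>. mass n y \<omega> * mass n y \<omega> \<partial>M))
      \<longlonglongrightarrow> of_nat attractor_card * (\<integral>\<^sup>+\<omega>. limit_mass y \<omega> * limit_mass y \<omega> \<partial>M)"
  proof (intro ennreal_tendsto_cmult nn_integral_bounded_convergence)
    show "AE \<omega> in M. (\<lambda>n. mass n y \<omega> * mass n y \<omega>) \<longlonglongrightarrow> limit_mass y \<omega> * limit_mass y \<omega>"
      using mass_tendsto
    proof eventually_elim
      case (elim \<omega>)
      have "limit_mass y \<omega> \<noteq> top" using limit_mass_le_1[of y \<omega>] by (auto simp: top_unique)
      then show ?case using elim by (intro tendsto_mult_ennreal) auto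
    qed
  qed (auto intro!: le1 mass_le_1 simp: of_nat_less_top)
  ultimately show ?thesis unfolding eq by (rule LIMSEQ_unique)
qed

text \<open>Compare \<open>f\<close> and \<open>g\<close>, the sums of \<kappa> \<mu>(y)^2 and of
  \<kappa> \<open>peak_mass\<close> \<mu>(y), where \<mu> is the limit mass. Termwise
  \<open>f\<close> is at most \<open>g\<close>. Both have mean \<kappa> \<open>peak_mass\<close>:
  the first by the second-moment identity, the second because \<mu> has total mass 1. So almost
  surely every \<mu>(y) is either 0 or \<open>peak_mass\<close>.\<close>

lemma limit_mass_outside_attractor: "AE \<omega> in M. \<forall>y. y \<notin> attractor \<omega> \<longrightarrow> limit_mass y \<omega> = 0"
proof -
  let ?k = "of_nat attractor_card :: ennreal"
  define f where "f \<omega> = (\<integral>\<^sup>+y. ?k * (limit_mass y \<omega> * limit_mass y \<omega>) \<partial>count_space UNIV)" for \<omega>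
  define g where "g \<omega> = (\<integral>\<^sup>+y. ?k * (peak_mass * limit_mass y \<omega>) \<partial>count_space UNIV)" for \<omega>
  have [measurable]: "f \<in> borel_measurable M" "g \<in> borel_measurable M"
    unfolding f_def[abs_def] g_def[abs_def] by (intro borel_measurable_nn_integral_count_space; measurable)+
  have "(\<integral>\<^sup>+\<omega>. f \<omega> \<partial>M) = (\<integral>\<^sup>+y. \<integral>\<^sup>+\<omega>. ?k * (limit_mass y \<omega> * limit_mass y \<omega>) \<partial>M \<partial>count_space UNIV)"
    unfolding f_def by (rule nn_integral_count_space_nn_integral) auto
  also have "\<dots> = (\<integral>\<^sup>+y. \<integral>\<^sup>+\<omega>. limit_mass y \<omega> * indicator (attractor \<omega>) y \<partial>M \<partial>count_space UNIV)"
    by (simp add: nn_integral_cmult nn_integral_limit_mass_attractor)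
  also have "\<dots> = (\<integral>\<^sup>+\<omega>. \<integral>\<^sup>+y. limit_mass y \<omega> * indicator (attractor \<omega>) y \<partial>count_space UNIV \<partial>M)"
    by (rule nn_integral_count_space_nn_integral[symmetric]) auto
  also have "\<dots> = (\<integral>\<^sup>+\<omega>. ?k * peak_mass \<partial>M)"
  proof (intro nn_integral_cong_AE)
    show "AE \<omega> in M. (\<integral>\<^sup>+y. limit_mass y \<omega> * indicator (attractor \<omega>) y \<partial>count_space UNIV) = ?k * peak_mass"
      using card_attractor attractor_finite
    proof eventually_elim
      case (elim \<omega>)
      have "(\<integral>\<^sup>+y. limit_mass y \<omega> * indicator (attractor \<omega>) y \<partial>count_space UNIV) = (\<Sum>y\<in>attractor \<omega>. limit_mass y \<omega>)"
        by (rule sum_eq_nn_integral_count_space[symmetric]) (rule elim)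
      also have "\<dots> = (\<Sum>y\<in>attractor \<omega>. peak_mass)" by (intro sum.cong) (auto simp: attractor_def)
      finally show ?case using elim by simp
    qed
  qed
  finally have f: "(\<integral>\<^sup>+\<omega>. f \<omega> \<partial>M) = ?k * peak_mass" by (simp add: emeasure_space_1)
  have "(\<integral>\<^sup>+\<omega>. g \<omega> \<partial>M) = (\<integral>\<^sup>+\<omega>. ?k * peak_mass \<partial>M)"
  proof (intro nn_integral_cong_AE)
    show "AE \<omega> in M. g \<omega> = ?k * peak_mass"
      using sum_limit_mass unfolding g_def by eventually_elim (simp add: nn_integral_cmult mult.assoc)
  qed
  then have g: "(\<integral>\<^sup>+\<omega>. g \<omega> \<partial>M) = ?k * peak_mass" by (simp add: emeasure_space_1)
  have pf: "?k * peak_mass < top" by (simp add: peak_mass_def ennreal_mult_less_top of_nat_less_top)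
  have le: "AE \<omega> in M. \<forall>y. ?k * (limit_mass y \<omega> * limit_mass y \<omega>) \<le> ?k * (peak_mass * limit_mass y \<omega>)"
    using limit_mass_le_peak by eventually_elim (auto intro!: mult_left_mono mult_right_mono)
  have "AE \<omega> in M. f \<omega> = g \<omega>"
  proof (rule AE_eq_of_nn_integral_le)
    show "AE \<omega> in M. f \<omega> \<le> g \<omega>"
      using le unfolding f_def g_def by eventually_elim (auto intro!: nn_integral_mono)
  qed (use f g pf in auto)
  moreover have "AE \<omega> in M. g \<omega> < \<infinity>"
    using sum_limit_mass unfolding g_def
    by eventually_elim (use pf in \<open>simp add: nn_integral_cmult mult.assoc\<close>)
  ultimately show ?thesis
    using le
  proof eventually_elim
    fix \<omega> assume eq: "f \<omega> = g \<omega>" and fin: "g \<omega> < \<infinity>"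
      and le: "\<forall>y. ?k * (limit_mass y \<omega> * limit_mass y \<omega>) \<le> ?k * (peak_mass * limit_mass y \<omega>)"
    show "\<forall>y. y \<notin> attractor \<omega> \<longrightarrow> limit_mass y \<omega> = 0"
    proof (intro allI impI, rule ccontr)
      fix y assume y: "y \<notin> attractor \<omega>" "limit_mass y \<omega> \<noteq> 0"
      have "?k * (limit_mass y \<omega> * limit_mass y \<omega>) = ?k * (peak_mass * limit_mass y \<omega>)"
        by (rule nn_integral_count_space_eqD[OF le[rule_format]]) (use eq fin in \<open>auto simp: f_def g_def\<close>)
      then have "(?k * limit_mass y \<omega>) * limit_mass y \<omega> = (?k * limit_mass y \<omega>) * peak_mass"
        by (simp add: mult_ac)
      moreover have "?k * limit_mass y \<omega> \<noteq> 0" using y attractor_card_positive by simp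
      moreover have "limit_mass y \<omega> < top" using limit_mass_le_1[of y \<omega>] by (rule order_le_less_trans) simp
      then have "?k * limit_mass y \<omega> \<noteq> top" by (simp add: ennreal_mult_eq_top_iff)
      ultimately have "limit_mass y \<omega> = peak_mass" by (simp add: ennreal_mult_cancel_left)
      then show False using y by (simp add: attractor_def)
    qed
  qed
qed

lemma attractor_attracts_pullback:
  "AE \<omega> in M. \<forall>x. \<exists>N. \<forall>n\<ge>N. \<phi> n (\<theta> (- int n) \<omega>) x \<in> attractor \<omega>"
  using mass_tendsto sum_limit_mass limit_mass_outside_attractor attractor_finite
proof eventually_elim
  fix \<omega> assume lim: "\<forall>y. (\<lambda>n. mass n y \<omega>) \<longlonglongrightarrow> limit_mass y \<omega>"
    and sum: "(\<integral>\<^sup>+y. limit_mass y \<omega> \<partial>count_space UNIV) = 1"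
    and zero: "\<forall>y. y \<notin> attractor \<omega> \<longrightarrow> limit_mass y \<omega> = 0" and fin: "finite (attractor \<omega>)"
  have "(\<Sum>y\<in>attractor \<omega>. limit_mass y \<omega>) = (\<integral>\<^sup>+y. limit_mass y \<omega> \<partial>count_space UNIV)"
    by (subst sum_eq_nn_integral_count_space[OF fin]) (use zero in \<open>auto intro!: nn_integral_cong simp: indicator_def\<close>)
  then have 1: "(\<Sum>y\<in>attractor \<omega>. limit_mass y \<omega>) = 1" using sum by simp
  \<comment> \<open>The sum runs over the fixed finite set \<open>attractor \<omega>\<close>, so
    convergence state by state suffices.\<close>
  have lim': "(\<lambda>n. \<Sum>y\<in>attractor \<omega>. mass n y \<omega>) \<longlonglongrightarrow> 1"
    unfolding 1[symmetric] by (intro tendsto_sum) (use lim in auto)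
  show "\<forall>x. \<exists>N. \<forall>n\<ge>N. \<phi> n (\<theta> (- int n) \<omega>) x \<in> attractor \<omega>"
  proof
    fix x
    let ?p = "ennreal (pmf \<pi> x)"
    \<comment> \<open>Adding \<open>?p\<close> to the inside mass avoids subtracting it from 1. Once
      the sum exceeds 1, no further state can hold the mass that \<open>x\<close> brings
      along.\<close>
    have "(\<lambda>n. ?p + (\<Sum>y\<in>attractor \<omega>. mass n y \<omega>)) \<longlonglongrightarrow> ?p + 1"
      by (intro tendsto_add lim' tendsto_const)
    moreover have "ennreal 1 < ennreal (pmf \<pi> x + 1)" using pmf_positive[of x] by (intro ennreal_lessI) auto
    then have "1 < ?p + 1" by (simp add: ennreal_plus)
    ultimately have "\<forall>\<^sub>F n in sequentially. 1 < ?p + (\<Sum>y\<in>attractor \<omega>. mass n y \<omega>)"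
      by (rule order_tendstoD(1))
    then obtain N where N: "\<And>n. N \<le> n \<Longrightarrow> 1 < ?p + (\<Sum>y\<in>attractor \<omega>. mass n y \<omega>)"
      by (auto simp: eventually_sequentially)
    have "\<phi> n (\<theta> (- int n) \<omega>) x \<in> attractor \<omega>" if "N \<le> n" for n
    proof (rule ccontr)
      let ?y = "\<phi> n (\<theta> (- int n) \<omega>) x"
      assume notin: "?y \<notin> attractor \<omega>"
      have "?p \<le> mass n ?y \<omega>"
        unfolding pullback_mass_def
        using nn_integral_count_space_ge[of "\<lambda>z. ennreal (pmf \<pi> z) * indicator {?y} (\<phi> n (\<theta> (- int n) \<omega>) z)" x]
        by simp
      then have "?p + (\<Sum>y\<in>attractor \<omega>. mass n y \<omega>) \<le> (\<Sum>y\<in>insert ?y (attractor \<omega>). mass n y \<omega>)"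
        using notin fin by (simp add: add_right_mono)
      also have "\<dots> \<le> (\<integral>\<^sup>+y. mass n y \<omega> \<partial>count_space UNIV)"
        using fin by (subst sum_eq_nn_integral_count_space) (auto intro!: nn_integral_mono simp: indicator_def)
      finally show False using N[OF that] by (simp add: sum_mass)
    qed
    then show "\<exists>N. \<forall>n\<ge>N. \<phi> n (\<theta> (- int n) \<omega>) x \<in> attractor \<omega>" by blast
  qed
qed

end

section \<open>Attraction and uniqueness\<close>

lemma eventually_subset_finite:
  assumes "finite S" "\<forall>x. \<exists>N. \<forall>n\<ge>N. f n x \<in> T n"
  shows "\<exists>N::nat. \<forall>n\<ge>N. f n ` S \<subseteq> T n"
proof -
  have "\<forall>\<^sub>F n in sequentially. \<forall>x\<in>S. f n x \<in> T n"
    using assms by (intro eventually_ball_finite) (auto simp: eventually_sequentially)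
  then show ?thesis by (auto simp: eventually_sequentially image_subset_iff)
qed

lemma (in prob_space) prob_tendsto_1_of_AE_eventually:
  assumes [measurable]: "\<And>n. Measurable.pred M (P n)"
    and ev: "AE \<omega> in M. \<exists>N. \<forall>n\<ge>N. P n \<omega>"
  shows "(\<lambda>n. \<P>(\<omega> in M. P n \<omega>)) \<longlonglongrightarrow> 1"
proof -
  have "(\<lambda>n. \<integral>\<^sup>+\<omega>. indicator {\<omega>\<in>space M. P n \<omega>} \<omega> \<partial>M) \<longlonglongrightarrow> (\<integral>\<^sup>+\<omega>. 1 \<partial>M)"
  proof (rule nn_integral_bounded_convergence)
    show "AE \<omega> in M. (\<lambda>n. indicator {\<omega>\<in>space M. P n \<omega>} \<omega> :: ennreal) \<longlonglongrightarrow> 1"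
      using ev AE_space
    proof eventually_elim
      case (elim \<omega>)
      then have "\<forall>\<^sub>F n in sequentially. indicator {\<omega>\<in>space M. P n \<omega>} \<omega> = (1 :: ennreal)"
        unfolding eventually_sequentially by (auto simp: indicator_def)
      then show ?case by (rule tendsto_eventually)
    qed
  qed (auto simp: indicator_def)
  then have "(\<lambda>n. ennreal (\<P>(\<omega> in M. P n \<omega>))) \<longlonglongrightarrow> ennreal 1"
    by (simp add: emeasure_eq_measure prob_space)
  then show ?thesis by (subst (asm) tendsto_ennreal_iff) auto
qed

section \<open>Measurability of attraction events, and the weakest notion of attraction\<close>

context rds
begin

lemma set_measurable_wrt_pred: "set_measurable_wrt M B \<longleftrightarrow> (\<forall>x. Measurable.pred M (\<lambda>\<omega>. x \<in> B \<omega>))"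
proof -
  have "(\<lambda>\<omega>. indicator (B \<omega>) x :: real) \<in> borel_measurable M \<longleftrightarrow> Measurable.pred M (\<lambda>\<omega>. x \<in> B \<omega>)" for x
  proof
    assume [measurable]: "(\<lambda>\<omega>. indicator (B \<omega>) x :: real) \<in> borel_measurable M"
    have "Measurable.pred M (\<lambda>\<omega>. indicator (B \<omega>) x = (1::real))" by measurable
    then show "Measurable.pred M (\<lambda>\<omega>. x \<in> B \<omega>)" by (simp add: indicator_eq_1_iff)
  next
    assume [measurable]: "Measurable.pred M (\<lambda>\<omega>. x \<in> B \<omega>)"
    have "(\<lambda>\<omega>. if x \<in> B \<omega> then 1 else 0 :: real) \<in> borel_measurable M" by measurable
    then show "(\<lambda>\<omega>. indicator (B \<omega>) x :: real) \<in> borel_measurable M" by (simp add: indicator_def of_bool_def)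
  qed
  then show ?thesis by (simp add: set_measurable_wrt_def)
qed

text \<open>Here both the point and the set are random. Naming the value \<open>y\<close> of the
  point turns membership into a countable conjunction of measurable conditions.\<close>

lemma phi_in_pred:
  assumes "\<And>x. Measurable.pred M (\<lambda>\<omega>. x \<in> A \<omega>)"
  shows "Measurable.pred M (\<lambda>\<omega>. \<phi> n (\<theta> m \<omega>) x \<in> A (\<theta> k \<omega>))"
proof -
  have [measurable]: "Measurable.pred M (\<lambda>\<omega>. y \<in> A (\<theta> k \<omega>))" for y
    by (rule measurable_compose[OF theta_measurable assms])
  have "Measurable.pred M (\<lambda>\<omega>. \<forall>y. \<phi> n (\<theta> m \<omega>) x = y \<longrightarrow> y \<in> A (\<theta> k \<omega>))" by measurable
  then show ?thesis by simp
qed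

lemma image_subset_pred:
  assumes A: "\<And>x. Measurable.pred M (\<lambda>\<omega>. x \<in> A \<omega>)" and B: "\<And>x. Measurable.pred M (\<lambda>\<omega>. x \<in> B \<omega>)"
  shows "Measurable.pred M (\<lambda>\<omega>. \<phi> n (\<theta> m \<omega>) ` B (\<theta> m \<omega>) \<subseteq> A (\<theta> k \<omega>))"
proof -
  have [measurable]: "Measurable.pred M (\<lambda>\<omega>. y \<in> B (\<theta> m \<omega>))" for y
    by (rule measurable_compose[OF theta_measurable B])
  note [measurable] = phi_in_pred[OF A]
  have "Measurable.pred M (\<lambda>\<omega>. \<forall>x. x \<in> B (\<theta> m \<omega>) \<longrightarrow> \<phi> n (\<theta> m \<omega>) x \<in> A (\<theta> k \<omega>))" by measurable
  then show ?thesis by (simp add: image_subset_iff Ball_def)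
qed

lemma pullback_subset_pred:
  assumes "\<And>x. Measurable.pred M (\<lambda>\<omega>. x \<in> A \<omega>)" "\<And>x. Measurable.pred M (\<lambda>\<omega>. x \<in> B \<omega>)"
  shows "Measurable.pred M (\<lambda>\<omega>. \<phi> n (\<theta> m \<omega>) ` B (\<theta> m \<omega>) \<subseteq> A \<omega>)"
  using image_subset_pred[OF assms, of n m 0]
  by (rule measurable_cong[THEN iffD1, rotated]) (simp add: theta_zero)

lemma forward_subset_pred:
  assumes "\<And>x. Measurable.pred M (\<lambda>\<omega>. x \<in> A \<omega>)" "\<And>x. Measurable.pred M (\<lambda>\<omega>. x \<in> B \<omega>)"
  shows "Measurable.pred M (\<lambda>\<omega>. \<phi> n \<omega> ` B \<omega> \<subseteq> A (\<theta> k \<omega>))"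
  using image_subset_pred[OF assms, of n 0 k]
  by (rule measurable_cong[THEN iffD1, rotated]) (simp add: theta_zero)

lemma prob_pullback_forward:
  assumes "\<And>x. Measurable.pred M (\<lambda>\<omega>. x \<in> A \<omega>)"
  shows "\<P>(\<omega> in M. \<phi> n \<omega> x \<in> A (\<theta> (int n) \<omega>)) = \<P>(\<omega> in M. \<phi> n (\<theta> (- int n) \<omega>) x \<in> A \<omega>)"
proof -
  have "Measurable.pred M (\<lambda>\<omega>. \<phi> n (\<theta> (- int n) \<omega>) ` {x} \<subseteq> A \<omega>)"
    by (rule pullback_subset_pred[OF assms, of "\<lambda>_. {x}"]) simp
  then have "{\<omega>\<in>space M. \<phi> n (\<theta> (- int n) \<omega>) x \<in> A \<omega>} \<in> sets M" by (simp add: pred_def)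
  from prob_theta[OF this, of "int n"] show ?thesis by (simp cong: conj_cong)
qed

text \<open>The common consequence of all the notions: singletons belong to each of the three
  families, almost sure eventual attraction implies attraction in probability, and measure
  preservation exchanges forward and pullback probabilities.\<close>

lemma some_attractor_attracts_points:
  assumes "some_attractor A"
  shows "(\<lambda>n. \<P>(\<omega> in M. \<phi> n (\<theta> (- int n) \<omega>) x \<in> A \<omega>)) \<longlonglongrightarrow> 1"
proof -
  have "invariant_compact_random_set A"
    using assms by (auto simp: some_attractor_def pullback_attractor_def forward_attractor_def weak_attractor_def)
  then have A: "Measurable.pred M (\<lambda>\<omega>. z \<in> A \<omega>)" for z
    by (auto simp: invariant_compact_random_set_def compact_random_set_def set_measurable_wrt_pred)
  have pp: "Measurable.pred M (\<lambda>\<omega>. \<phi> n (\<theta> (- int n) \<omega>) ` {x} \<subseteq> A \<omega>)" for n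
    by (rule pullback_subset_pred[OF A, of "\<lambda>_. {x}"]) simp
  have fp: "Measurable.pred M (\<lambda>\<omega>. \<phi> n \<omega> ` {x} \<subseteq> A (\<theta> (int n) \<omega>))" for n
    by (rule forward_subset_pred[OF A, of "\<lambda>_. {x}"]) simp
  have "(\<lambda>_. {x}) \<in> compact_random_sets" "(\<lambda>_. {x}) \<in> finite_deterministic_sets" "(\<lambda>_. {x}) \<in> deterministic_points"
    by (auto simp: compact_random_sets_def compact_random_set_def set_measurable_wrt_def
        finite_deterministic_sets_def deterministic_points_def)
  then obtain \<B> where B: "(\<lambda>_. {x}) \<in> \<B>" "pullback_attractor \<B> A \<or> forward_attractor \<B> A \<or> weak_attractor \<B> A"
    using assms unfolding some_attractor_def by blast
  from B(2) show ?thesis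
  proof (elim disjE)
    assume "pullback_attractor \<B> A"
    then have "\<P>(\<omega> in M. \<exists>N. \<forall>n\<ge>N. \<phi> n (\<theta> (- int n) \<omega>) ` {x} \<subseteq> A \<omega>) = 1"
      using B(1) by (auto simp: pullback_attractor_def)
    then have "AE \<omega> in M. \<exists>N. \<forall>n\<ge>N. \<phi> n (\<theta> (- int n) \<omega>) ` {x} \<subseteq> A \<omega>"
      using pp by (subst (asm) prob_Collect_eq_1) measurable
    from prob_tendsto_1_of_AE_eventually[OF pp this] show ?thesis by simp
  next
    assume "forward_attractor \<B> A"
    then have "\<P>(\<omega> in M. \<exists>N. \<forall>n\<ge>N. \<phi> n \<omega> ` {x} \<subseteq> A (\<theta> (int n) \<omega>)) = 1"
      using B(1) by (auto simp: forward_attractor_def)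
    then have "AE \<omega> in M. \<exists>N. \<forall>n\<ge>N. \<phi> n \<omega> ` {x} \<subseteq> A (\<theta> (int n) \<omega>)"
      using fp by (subst (asm) prob_Collect_eq_1) measurable
    from prob_tendsto_1_of_AE_eventually[OF fp this] show ?thesis
      by (simp add: prob_pullback_forward[OF A])
  next
    assume "weak_attractor \<B> A"
    then show ?thesis using B(1) by (auto simp: weak_attractor_def)
  qed
qed

end

section \<open>Attraction by the maximal atoms, and comparison with other attractors\<close>

context stationary_markov_rds
begin

text \<open>Measure preservation transfers only the probability at each fixed time, not the almost
  sure statement. Since these probabilities tend to 1, the orbit almost surely enters the attractor
  at some time, and invariance keeps it there.\<close>

lemma attractor_attracts_forward:
  "AE \<omega> in M. \<forall>x. \<exists>N. \<forall>n\<ge>N. \<phi> n \<omega> x \<in> attractor (\<theta> (int n) \<omega>)"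
proof (subst AE_all_countable, rule allI)
  fix x
  have fp[measurable]: "Measurable.pred M (\<lambda>\<omega>. \<phi> n \<omega> x \<in> attractor (\<theta> (int n) \<omega>))" for n
    using forward_subset_pred[of attractor "\<lambda>_. {x}" n "int n", OF attractor_pred] by simp
  have pp: "Measurable.pred M (\<lambda>\<omega>. \<phi> n (\<theta> (- int n) \<omega>) x \<in> attractor \<omega>)" for n
    using pullback_subset_pred[of attractor "\<lambda>_. {x}" n "- int n", OF attractor_pred] by simp
  have "AE \<omega> in M. \<exists>N. \<forall>n\<ge>N. \<phi> n (\<theta> (- int n) \<omega>) x \<in> attractor \<omega>"
    using attractor_attracts_pullback by eventually_elim blast
  from prob_tendsto_1_of_AE_eventually[OF pp this]
  have lim: "(\<lambda>n. \<P>(\<omega> in M. \<phi> n \<omega> x \<in> attractor (\<theta> (int n) \<omega>))) \<longlonglongrightarrow> 1"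
    by (simp add: prob_pullback_forward[OF attractor_pred])
  have "\<P>(\<omega> in M. \<phi> n \<omega> x \<in> attractor (\<theta> (int n) \<omega>)) \<le> \<P>(\<omega> in M. \<exists>n. \<phi> n \<omega> x \<in> attractor (\<theta> (int n) \<omega>))" for n
    by (intro finite_measure_mono) auto
  with lim have "1 \<le> \<P>(\<omega> in M. \<exists>n. \<phi> n \<omega> x \<in> attractor (\<theta> (int n) \<omega>))"
    by (intro LIMSEQ_le_const2) auto
  then have "\<P>(\<omega> in M. \<exists>n. \<phi> n \<omega> x \<in> attractor (\<theta> (int n) \<omega>)) = 1"
    using prob_le_1 by (intro antisym)
  then have ex: "AE \<omega> in M. \<exists>n. \<phi> n \<omega> x \<in> attractor (\<theta> (int n) \<omega>)"
    by (subst (asm) prob_Collect_eq_1) measurable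
  have "AE \<omega> in M. \<forall>n. \<phi> 1 (\<theta> (int n) \<omega>) ` attractor (\<theta> (int n) \<omega>) = attractor (\<theta> 1 (\<theta> (int n) \<omega>))"
    by (subst AE_all_countable) (intro allI AE_theta attractor_invariant)
  with ex AE_space show "AE \<omega> in M. \<exists>N. \<forall>n\<ge>N. \<phi> n \<omega> x \<in> attractor (\<theta> (int n) \<omega>)"
  proof eventually_elim
    fix \<omega> assume \<omega>: "\<omega> \<in> space M" and "\<exists>n. \<phi> n \<omega> x \<in> attractor (\<theta> (int n) \<omega>)"
      and inv: "\<forall>n. \<phi> 1 (\<theta> (int n) \<omega>) ` attractor (\<theta> (int n) \<omega>) = attractor (\<theta> 1 (\<theta> (int n) \<omega>))"
    then obtain N where N: "\<phi> N \<omega> x \<in> attractor (\<theta> (int N) \<omega>)" by blast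
    have "\<phi> n \<omega> x \<in> attractor (\<theta> (int n) \<omega>)" if "N \<le> n" for n
      using that
    proof (induction rule: dec_induct)
      case (step n)
      then have "\<phi> 1 (\<theta> (int n) \<omega>) (\<phi> n \<omega> x) \<in> attractor (\<theta> 1 (\<theta> (int n) \<omega>))" using inv by blast
      then show ?case using phi_cocycle[OF \<omega>, of 1 n x] theta_add[OF \<omega>, of 1 "int n"] by simp
    qed (rule N)
    then show "\<exists>N. \<forall>n\<ge>N. \<phi> n \<omega> x \<in> attractor (\<theta> (int n) \<omega>)" by blast
  qed
qed

lemma attractor_pullback_finite: "pullback_attractor finite_deterministic_sets attractor"
  unfolding pullback_attractor_def
proof (intro conjI ballI)
  fix B :: "'w \<Rightarrow> 'x set" assume "B \<in> finite_deterministic_sets"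
  then obtain K where K: "finite K" "B = (\<lambda>_. K)" by (auto simp: finite_deterministic_sets_def)
  have [measurable]: "Measurable.pred M (\<lambda>\<omega>. \<phi> n (\<theta> (- int n) \<omega>) ` B (\<theta> (- int n) \<omega>) \<subseteq> attractor \<omega>)" for n
    by (rule pullback_subset_pred) (auto simp: K)
  have "AE \<omega> in M. \<exists>N. \<forall>n\<ge>N. \<phi> n (\<theta> (- int n) \<omega>) ` B (\<theta> (- int n) \<omega>) \<subseteq> attractor \<omega>"
    using attractor_attracts_pullback
    by eventually_elim (simp add: K eventually_subset_finite)
  then show "\<P>(\<omega> in M. \<exists>N. \<forall>n\<ge>N. \<phi> n (\<theta> (- int n) \<omega>) ` B (\<theta> (- int n) \<omega>) \<subseteq> attractor \<omega>) = 1"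
    by (subst prob_Collect_eq_1) measurable
qed (rule invariant_compact_attractor)

text \<open>The exceptional null set of \<open>attractor_attracts_forward\<close> serves all states
  at once, so the points may depend on \<omega>.\<close>

lemma attractor_attracts_forward_compact:
  assumes "compact_random_set B"
  shows "AE \<omega> in M. \<exists>N. \<forall>n\<ge>N. \<phi> n \<omega> ` B \<omega> \<subseteq> attractor (\<theta> (int n) \<omega>)"
proof -
  have "AE \<omega> in M. finite (B \<omega>)" using assms by (simp add: compact_random_set_def)
  with attractor_attracts_forward show ?thesis
    by eventually_elim (rule eventually_subset_finite)
qed

lemma attractor_forward_compact: "forward_attractor compact_random_sets attractor"
  unfolding forward_attractor_def
proof (intro conjI ballI)
  fix B :: "'w \<Rightarrow> 'x set" assume "B \<in> compact_random_sets"
  then have B: "compact_random_set B" by (simp add: compact_random_sets_def)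
  have [measurable]: "Measurable.pred M (\<lambda>\<omega>. \<phi> n \<omega> ` B \<omega> \<subseteq> attractor (\<theta> (int n) \<omega>))" for n
    by (rule forward_subset_pred) (use B in \<open>auto simp: compact_random_set_def set_measurable_wrt_pred\<close>)
  show "\<P>(\<omega> in M. \<exists>N. \<forall>n\<ge>N. \<phi> n \<omega> ` B \<omega> \<subseteq> attractor (\<theta> (int n) \<omega>)) = 1"
    using attractor_attracts_forward_compact[OF B] by (subst prob_Collect_eq_1) measurable
qed (rule invariant_compact_attractor)

text \<open>With \<open>r\<close> marking the complement of \<open>A\<close>, \<open>q n x\<close>
  is the probability that \<open>x\<close>, started at time \<open>- n\<close>, misses
  \<open>A\<close> at time 0. Its \<pi>-average tends to 0 by dominated convergence and bounds the
  expected mass outside \<open>A\<close>. Hence the limit mass charges no state outside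
  \<open>A\<close>, whereas every point of the attractor has positive mass.\<close>

lemma attractor_subset_of_attracts_points:
  assumes A[measurable]: "\<And>x. Measurable.pred M (\<lambda>\<omega>. x \<in> A \<omega>)"
    and lim: "\<And>x. (\<lambda>n. \<P>(\<omega> in M. \<phi> n (\<theta> (- int n) \<omega>) x \<in> A \<omega>)) \<longlonglongrightarrow> 1"
  shows "AE \<omega> in M. attractor \<omega> \<subseteq> A \<omega>"
proof -
  define r where "r y \<omega> = (if y \<in> A \<omega> then 0 else 1 :: ennreal)" for y \<omega>
  have [measurable]: "r y \<in> borel_measurable M" for y unfolding r_def[abs_def] by measurable
  have pp[measurable]: "Measurable.pred M (\<lambda>\<omega>. \<phi> n (\<theta> (- int n) \<omega>) x \<in> A \<omega>)" for n x
    using pullback_subset_pred[of A "\<lambda>_. {x}" n "- int n", OF A] by simp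
  have rr[measurable]: "(\<lambda>\<omega>. r (\<phi> n (\<theta> (- int n) \<omega>) x) \<omega>) \<in> borel_measurable M" for n x
    unfolding r_def by measurable
  define q where "q n x = (\<integral>\<^sup>+\<omega>. r (\<phi> n (\<theta> (- int n) \<omega>) x) \<omega> \<partial>M)" for n x
  have q: "(\<lambda>n. q n x) \<longlonglongrightarrow> 0" for x
  proof -
    have "q n x = ennreal (1 - \<P>(\<omega> in M. \<phi> n (\<theta> (- int n) \<omega>) x \<in> A \<omega>))" for n
    proof -
      have "q n x = (\<integral>\<^sup>+\<omega>. indicator {\<omega>\<in>space M. \<not> \<phi> n (\<theta> (- int n) \<omega>) x \<in> A \<omega>} \<omega> \<partial>M)"
        unfolding q_def by (intro nn_integral_cong) (auto simp: r_def)
      also have "\<dots> = ennreal (\<P>(\<omega> in M. \<not> \<phi> n (\<theta> (- int n) \<omega>) x \<in> A \<omega>))"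
        by (simp add: emeasure_eq_measure)
      finally show ?thesis by (subst (asm) prob_neg) auto
    qed
    moreover have "(\<lambda>n. ennreal (1 - \<P>(\<omega> in M. \<phi> n (\<theta> (- int n) \<omega>) x \<in> A \<omega>))) \<longlonglongrightarrow> ennreal (1 - 1)"
      by (intro tendsto_ennrealI tendsto_diff tendsto_const lim)
    ultimately show ?thesis by simp
  qed
  have q1: "q n x \<le> 1" for n x
  proof -
    have "q n x \<le> (\<integral>\<^sup>+\<omega>. 1 \<partial>M)" unfolding q_def by (intro nn_integral_mono) (auto simp: r_def)
    then show ?thesis by (simp add: emeasure_space_1)
  qed
  have "(\<lambda>n. \<integral>\<^sup>+x. ennreal (pmf \<pi> x) * q n x \<partial>count_space UNIV) \<longlonglongrightarrow> (\<integral>\<^sup>+(x::'x). 0 \<partial>count_space UNIV)"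
  proof (rule nn_integral_dominated_convergence[where w="\<lambda>x. ennreal (pmf \<pi> x)"])
    show "AE x in count_space UNIV. ennreal (pmf \<pi> x) * q n x \<le> ennreal (pmf \<pi> x)" for n
      using mult_left_mono[OF q1] by (intro AE_I2) fastforce
    have "(\<lambda>n. ennreal (pmf \<pi> x) * q n x) \<longlonglongrightarrow> ennreal (pmf \<pi> x) * 0" for x
      by (intro ennreal_tendsto_cmult q) auto
    then show "AE x in count_space UNIV. (\<lambda>n. ennreal (pmf \<pi> x) * q n x) \<longlonglongrightarrow> 0" by simp
  qed (auto simp: sum_pmf)
  then have d: "(\<lambda>n. \<integral>\<^sup>+x. ennreal (pmf \<pi> x) * q n x \<partial>count_space UNIV) \<longlonglongrightarrow> 0" by simp
  have "AE \<omega> in M. limit_mass y \<omega> * r y \<omega> = 0" for y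
  proof -
    have "(\<lambda>n. \<integral>\<^sup>+\<omega>. mass n y \<omega> * r y \<omega> \<partial>M) \<longlonglongrightarrow> (\<integral>\<^sup>+\<omega>. limit_mass y \<omega> * r y \<omega> \<partial>M)"
    proof (rule nn_integral_bounded_convergence)
      show "AE \<omega> in M. (\<lambda>n. mass n y \<omega> * r y \<omega>) \<longlonglongrightarrow> limit_mass y \<omega> * r y \<omega>"
        using mass_tendsto by eventually_elim (auto simp: r_def)
    qed (auto simp: r_def mass_le_1)
    moreover have "(\<integral>\<^sup>+\<omega>. mass n y \<omega> * r y \<omega> \<partial>M) \<le> (\<integral>\<^sup>+x. ennreal (pmf \<pi> x) * q n x \<partial>count_space UNIV)" for n
    proof -
      have "(\<integral>\<^sup>+\<omega>. mass n y \<omega> * r y \<omega> \<partial>M)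
         \<le> (\<integral>\<^sup>+\<omega>. \<integral>\<^sup>+x. ennreal (pmf \<pi> x) * r (\<phi> n (\<theta> (- int n) \<omega>) x) \<omega> \<partial>count_space UNIV \<partial>M)"
        unfolding pullback_mass_def
        by (intro nn_integral_mono, subst nn_integral_multc[symmetric])
          (auto intro!: nn_integral_mono simp: indicator_def)
      also have "\<dots> = (\<integral>\<^sup>+x. \<integral>\<^sup>+\<omega>. ennreal (pmf \<pi> x) * r (\<phi> n (\<theta> (- int n) \<omega>) x) \<omega> \<partial>M \<partial>count_space UNIV)"
        by (rule nn_integral_count_space_nn_integral) auto
      also have "\<dots> = (\<integral>\<^sup>+x. ennreal (pmf \<pi> x) * q n x \<partial>count_space UNIV)"
        unfolding q_def by (simp add: nn_integral_cmult)
      finally show ?thesis .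
    qed
    ultimately have "(\<integral>\<^sup>+\<omega>. limit_mass y \<omega> * r y \<omega> \<partial>M) \<le> 0"
      using d by (intro LIMSEQ_le) auto
    then show ?thesis by (simp add: nn_integral_0_iff_AE)
  qed
  then have "AE \<omega> in M. \<forall>y. limit_mass y \<omega> * r y \<omega> = 0" by (simp add: AE_all_countable)
  then show ?thesis
  proof eventually_elim
    fix \<omega> assume *: "\<forall>y. limit_mass y \<omega> * r y \<omega> = 0"
    show "attractor \<omega> \<subseteq> A \<omega>"
    proof
      fix y assume "y \<in> attractor \<omega>"
      then have "limit_mass y \<omega> \<noteq> 0" using peak_mass_positive by (simp add: attractor_def)
      then have "r y \<omega> = 0" using * by auto
      then show "y \<in> A \<omega>" by (simp add: r_def split: if_splits)
    qed
  qed
qed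

text \<open>\<open>A\<close> is itself a compact random set, so it is attracted in forward time. By
  invariance its image after \<open>n\<close> steps is its own shifted copy, so the probability of
  inclusion does not depend on \<open>n\<close>; having limit 1, it equals 1.\<close>

lemma attractor_supset_of_invariant:
  assumes A: "invariant_compact_random_set A"
  shows "AE \<omega> in M. A \<omega> \<subseteq> attractor \<omega>"
proof -
  have c: "compact_random_set A" and inv: "AE \<omega> in M. \<phi> 1 \<omega> ` A \<omega> = A (\<theta> 1 \<omega>)"
    using A by (auto simp: invariant_compact_random_set_def)
  then have [measurable]: "Measurable.pred M (\<lambda>\<omega>. x \<in> A \<omega>)" for x
    by (auto simp: compact_random_set_def set_measurable_wrt_pred)
  have "Measurable.pred M (\<lambda>\<omega>. \<forall>x. x \<in> A \<omega> \<longrightarrow> x \<in> attractor \<omega>)" by measurable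
  then have sub[measurable]: "Measurable.pred M (\<lambda>\<omega>. A \<omega> \<subseteq> attractor \<omega>)" by (simp add: subset_eq Ball_def)
  have fp[measurable]: "Measurable.pred M (\<lambda>\<omega>. \<phi> n \<omega> ` A \<omega> \<subseteq> attractor (\<theta> (int n) \<omega>))" for n
    by (rule forward_subset_pred) measurable
  have [measurable]: "Measurable.pred M (\<lambda>\<omega>. A (\<theta> (int n) \<omega>) \<subseteq> attractor (\<theta> (int n) \<omega>))" for n
    by (rule measurable_compose[OF theta_measurable sub])
  have eq: "\<P>(\<omega> in M. \<phi> n \<omega> ` A \<omega> \<subseteq> attractor (\<theta> (int n) \<omega>)) = \<P>(\<omega> in M. A \<omega> \<subseteq> attractor \<omega>)" for n
  proof -
    have "\<P>(\<omega> in M. \<phi> n \<omega> ` A \<omega> \<subseteq> attractor (\<theta> (int n) \<omega>))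
        = \<P>(\<omega> in M. A (\<theta> (int n) \<omega>) \<subseteq> attractor (\<theta> (int n) \<omega>))"
    proof (rule finite_measure_eq_AE)
      show "AE \<omega> in M. \<omega> \<in> {\<omega>\<in>space M. \<phi> n \<omega> ` A \<omega> \<subseteq> attractor (\<theta> (int n) \<omega>)}
        \<longleftrightarrow> \<omega> \<in> {\<omega>\<in>space M. A (\<theta> (int n) \<omega>) \<subseteq> attractor (\<theta> (int n) \<omega>)}"
        using AE_invariant_iterate[OF inv] by eventually_elim simp
    qed measurable
    also have "\<dots> = \<P>(\<omega> in M. A \<omega> \<subseteq> attractor \<omega>)" by (rule prob_theta) measurable
    finally show ?thesis .
  qed
  have "\<P>(\<omega> in M. A \<omega> \<subseteq> attractor \<omega>) = 1"
    using prob_tendsto_1_of_AE_eventually[OF fp attractor_attracts_forward_compact[OF c]]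
    by (simp add: eq LIMSEQ_const_iff)
  then show ?thesis by (subst (asm) prob_Collect_eq_1) measurable
qed

lemma attractor_unique:
  assumes "invariant_compact_random_set A" "some_attractor A"
  shows "AE \<omega> in M. A \<omega> = attractor \<omega>"
proof -
  have "Measurable.pred M (\<lambda>\<omega>. x \<in> A \<omega>)" for x
    using assms(1) by (auto simp: invariant_compact_random_set_def compact_random_set_def set_measurable_wrt_pred)
  from attractor_subset_of_attracts_points[OF this some_attractor_attracts_points[OF assms(2)]]
    attractor_supset_of_invariant[OF assms(1)]
  show ?thesis by eventually_elim (rule antisym)
qed

end

theorem theorem3p1:
  fixes M :: "'w measure"
    and \<theta> :: "int \<Rightarrow> 'w \<Rightarrow> 'w"
    and \<phi> :: "nat \<Rightarrow> 'w \<Rightarrow> 'x :: countable \<Rightarrow> 'x"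
    and \<pi> :: "'x pmf"
  assumes "markov_rds M \<theta> \<phi>"
    and "rds.irreducible_chain M \<phi>"
    and "rds.positive_recurrent_chain M \<phi>"
    and "rds.stationary_distribution M \<phi> \<pi>"
  shows "\<exists>A :: 'w \<Rightarrow> 'x set.
    (rds.invariant_compact_random_set M \<theta> \<phi> A \<and>
     rds.set_measurable_wrt (rds.past_algebra M \<theta> \<phi> 0) A \<and>
     rds.pullback_attractor M \<theta> \<phi> rds.finite_deterministic_sets A \<and>
     rds.forward_attractor M \<theta> \<phi> (rds.compact_random_sets M) A) \<and>
    (\<forall>A'. rds.invariant_compact_random_set M \<theta> \<phi> A' \<and> rds.some_attractor M \<theta> \<phi> A' \<longrightarrow>
       (AE \<omega> in M. A' \<omega> = A \<omega>)) \<and>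
    (\<exists>\<kappa>::nat. \<kappa> > 0 \<and>
       (AE \<omega> in M. card (A \<omega>) = \<kappa>) \<and>
       (\<forall>x. \<P>(\<omega> in M. x \<in> A \<omega>) = real \<kappa> * pmf \<pi> x))"
proof -
  interpret markov_rds M \<theta> \<phi> by (rule assms)
  interpret stationary_markov_rds M \<theta> \<phi> \<pi> by unfold_locales (rule assms)+
  show ?thesis
  proof (intro exI[of _ attractor] conjI allI impI exI[of _ attractor_card])
    show "AE \<omega> in M. A' \<omega> = attractor \<omega>"
      if "invariant_compact_random_set A' \<and> some_attractor A'" for A'
      using attractor_unique that by blast
  qed (fact invariant_compact_attractor attractor_set_measurable_past attractor_pullback_finite
      attractor_forward_compact attractor_card_positive card_attractor prob_attractor)+
qed

end
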